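(* Let $h_Z:\overline{\mathbb{Q}}\to\mathbb{R}$, $h_Z(\alpha)=h(\alpha)+h(1-\alpha)$, be the Zhang-Zagier height. Then the image of $h_Z$ is dense in the interval $[0.31944909,\infty)$ (i.e. every point of this interval is a limit of values of $h_Z$). In particular, $\mu^{ess}(h_Z)\le 0.31944909$.
   Context: $\overline{\mathbb{Q}}\subset\mathbb{C}$ is the field of algebraic numbers. $h:\overline{\mathbb{Q}}\to\mathbb{R}$ is the absolute logarithmic Weil height: $h(\alpha)=\frac{1}{[K:\mathbb{Q}]}\sum_{\nu\in M_K}\log^+|\alpha|_\nu$ for any number field $K\ni\alpha$, where $M_K$ is the set of places of $K$, the absolute values are normalized (with local degrees as exponents) so that the product formula holds, $\log^+ x=\max(\log x,0)$ and $\log^+0=0$. For a function $f:\overline{\mathbb{Q}}\to\mathbb{R}$, the essential minimum is $\mu^{ess}(f)=\inf\{\theta\in\mathbb{R}:\{\alpha\in\overline{\mathbb{Q}}: f(\alpha)\le\theta\}\text{ is infinite}\}$. *)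

theory Defs
  imports
    "HOL-Analysis.Analysis"
    "HOL-Algebra.Algebra"
    "HOL-Algebra.Algebraic_Closure_Type"
begin

abbreviation complex_field :: "complex ring" where
  "complex_field \<equiv> ring_of_type_algebra"

text \<open>
  An absolute value is a function on the subfield \<open>K\<close> only; it is made extensional so that two
  absolute values which agree on \<open>K\<close> are equal, and are not counted twice among the places.
\<close>

definition absolute_value :: "complex set \<Rightarrow> (complex \<Rightarrow> real) \<Rightarrow> bool" where
  "absolute_value K v \<longleftrightarrow>
     v \<in> extensional K \<and>
     (\<forall>x\<in>K. 0 \<le> v x) \<and>
     (\<forall>x\<in>K. v x = 0 \<longleftrightarrow> x = 0) \<and>
     (\<forall>x\<in>K. \<forall>y\<in>K. v (x * y) = v x * v y) \<and>
     (\<forall>x\<in>K. \<forall>y\<in>K. v (x + y) \<le> v x + v y)"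

definition padic_abs :: "nat \<Rightarrow> rat \<Rightarrow> real" where
  "padic_abs p q =
     (if q = 0 then 0
      else real p powi (int (multiplicity (int p) (snd (quotient_of q)))
                        - int (multiplicity (int p) (fst (quotient_of q)))))"

text \<open>
  By Ostrowski's theorem every place of a number field \<open>K\<close>, that is, every equivalence class of
  nontrivial absolute values on \<open>K\<close>, contains exactly one absolute value whose restriction to the
  rationals is the usual or a \<open>p\<close>-adic one. Places are represented by these absolute values. The
  normalized absolute value satisfying the product formula is then \<open>\<lambda>x. v x ^ local_degree K v\<close>,
  with \<open>local_degree\<close> as below.
\<close>

definition places :: "complex set \<Rightarrow> (complex \<Rightarrow> real) set" where
  "places K =
     {v. absolute_value K v \<and>
         ((\<forall>q. v (of_rat q) = \<bar>of_rat q\<bar>) \<or>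
          (\<exists>p. Factorial_Ring.prime p \<and> (\<forall>q. v (of_rat q) = padic_abs p q)))}"

text \<open>
  The completion \<open>K\<^sub>v\<close> is the ring of \<open>v\<close>-Cauchy sequences in \<open>K\<close> modulo the ideal of null sequences.
  The completion \<open>\<rat>\<^sub>v\<close> of the rationals is the subfield consisting of the classes of Cauchy
  sequences of rational numbers, and the local degree is \<open>[K\<^sub>v : \<rat>\<^sub>v]\<close>.
\<close>

definition cauchy_seqs :: "complex set \<Rightarrow> (complex \<Rightarrow> real) \<Rightarrow> (nat \<Rightarrow> complex) set" where
  "cauchy_seqs K v =
     {s. range s \<subseteq> K \<and> (\<forall>e>0. \<exists>N. \<forall>m\<ge>N. \<forall>n\<ge>N. v (s m - s n) < e)}"

definition cauchy_ring :: "complex set \<Rightarrow> (complex \<Rightarrow> real) \<Rightarrow> (nat \<Rightarrow> complex) ring" where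
  "cauchy_ring K v =
     \<lparr> carrier = cauchy_seqs K v,
       monoid.mult = (\<lambda>s t n. s n * t n), one = (\<lambda>_. 1),
       ring.zero = (\<lambda>_. 0), ring.add = (\<lambda>s t n. s n + t n) \<rparr>"

definition null_seqs :: "complex set \<Rightarrow> (complex \<Rightarrow> real) \<Rightarrow> (nat \<Rightarrow> complex) set" where
  "null_seqs K v = {s \<in> cauchy_seqs K v. (\<lambda>n. v (s n)) \<longlonglongrightarrow> 0}"

definition completion :: "complex set \<Rightarrow> (complex \<Rightarrow> real) \<Rightarrow> (nat \<Rightarrow> complex) set ring" where
  "completion K v = cauchy_ring K v Quot null_seqs K v"

definition rat_completion :: "complex set \<Rightarrow> (complex \<Rightarrow> real) \<Rightarrow> (nat \<Rightarrow> complex) set set" where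
  "rat_completion K v = (\<lambda>s. null_seqs K v +>\<^bsub>cauchy_ring K v\<^esub> s) ` cauchy_seqs \<rat> v"

definition local_degree :: "complex set \<Rightarrow> (complex \<Rightarrow> real) \<Rightarrow> nat" where
  "local_degree K v =
     ring.dim (completion K v) (rat_completion K v) (carrier (completion K v))"

definition log_plus :: "real \<Rightarrow> real" where
  "log_plus x = (if x = 0 then 0 else max (ln x) 0)"

definition height_over :: "complex set \<Rightarrow> complex \<Rightarrow> real" where
  "height_over K \<alpha> =
     1 / real (ring.dim complex_field \<rat> K) *
     (\<Sum>\<^sub>\<infinity>v\<in>places K. log_plus (v \<alpha> ^ local_degree K v))"

text \<open>
  The value of \<open>height_over K \<alpha>\<close> is the same for every number field \<open>K\<close> containing \<open>\<alpha>\<close>; the height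
  is evaluated in the smallest one, \<open>\<rat>(\<alpha>)\<close>.
\<close>

definition weil_height :: "complex \<Rightarrow> real" where
  "weil_height \<alpha> = height_over (generate_field complex_field {\<alpha>}) \<alpha>"

definition zhang_zagier_height :: "complex \<Rightarrow> real" where
  "zhang_zagier_height \<alpha> = weil_height \<alpha> + weil_height (1 - \<alpha>)"

text \<open>
  The infimum is taken in the extended reals, because the real-valued \<open>Inf\<close> has an unspecified value
  on sets that are empty or unbounded below.
\<close>

definition essential_minimum :: "(complex \<Rightarrow> real) \<Rightarrow> ereal" where
  "essential_minimum f =
     Inf (ereal ` {\<theta>. infinite {\<alpha>. algebraic \<alpha> \<and> f \<alpha> \<le> \<theta>}})"

end

theory Submission
  imports Defs "HOL-Complex_Analysis.Complex_Analysis" "HOL-Library.Z2"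
begin

text \<open>
  The heights are realised by the roots of \<open>Q\<^sup>n + c\<close>, where \<open>Q = w\<^sup>2 - w + 1\<close> with \<open>w = z - z\<^sup>2\<close>, \<open>n\<close> is even
  and \<open>c\<close> is 2 modulo 4. As \<open>Q\<close> is irreducible modulo 2, these polynomials are irreducible; they have no
  real roots, and \<open>Q (1 - z) = Q z\<close> makes \<open>\<alpha>\<close> and \<open>1 - \<alpha>\<close> conjugate. Hence the height of a root is the
  logarithmic Mahler measure of \<open>Q\<^sup>n + c\<close> divided by \<open>2 n\<close>, which is the mean over the \<open>n\<close>-th roots \<open>b\<close> of
  \<open>- c\<close> of a continuous function of \<open>b\<close>. Replacing \<open>c\<close> by \<open>c + 4\<close> multiplies these roots by at most
  \<open>root n 3\<close>, so for large \<open>n\<close> the heights grow to infinity in arbitrarily small steps. They start, at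
  \<open>c = 2\<close>, below 0.31944909: the mean of \<open>max 0 (ln \<bar>Q\<bar>) / 2\<close> on the unit circle is about 0.3106.

  Since the fields involved are totally complex and their generators are algebraic integers, only
  archimedean places of local degree 2 contribute to the heights.
\<close>

text \<open>The heuristic behind the family is Jensen's formula: with t the n-th root of c, the
  height of a root is close, for large n, to half the mean of max (ln t) (ln |Q|) over the unit
  circle. This explains both the starting value, at t = 1, and the growth with t. The proof works
  with inequalities in place of the limit: an upper one from a polynomial majorant of max 1 |Q| on
  the circle, a lower one from the constant term 1 + c. The gap between 0.3106 and 0.31944909 leaves
  room for a majorant with small integer coefficients. The main obstacle is the height itself, which
  is defined through absolute values and completions. An archimedean absolute value has to be traced
  back to a complex root, and its completion identified with the complex numbers; the absence of
  real roots leaves a single type of such place. At the other places integrality gives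
  \<open>v \<alpha> \<le> 1\<close>, so their terms vanish whatever the local degree. Density comes
  from a discrete intermediate value argument in c for one fixed n.\<close>

hide_const (open) up_ring.coeff up_ring.monom Polynomials.degree Polynomials.lead_coeff
  Coset.order module.smult Divisibility.prime Divisibility.irreducible

section \<open>Irreducibility\<close>

text \<open>A relation of minimal degree is a factor of every multiple of itself by a nonzero integer, so a
  prime element cannot be a relation of larger degree (pseudo-division replaces Gauss's lemma).\<close>

lemma irreducible_int_poly_min_degree:
  fixes F g :: "int poly" and a :: "'a :: field_char_0"
  assumes F: "irreducible F" "degree F > 0" "poly (map_poly of_int F) a = 0"
    and g: "g \<noteq> 0" "poly (map_poly of_int g) a = 0"
  shows "degree F \<le> degree g"
proof -
  define R where "R = (\<lambda>g::int poly. g \<noteq> 0 \<and> poly (map_poly of_int g) a = 0)"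
  define h where "h = arg_min degree R"
  have "R g" using g by (simp add: R_def)
  then have Rh: "R h" and hmin: "\<And>y. R y \<Longrightarrow> degree h \<le> degree y"
    unfolding h_def using arg_min_nat_lemma[of R g degree] by auto
  have h0: "h \<noteq> 0" and ha: "poly (map_poly of_int h) a = 0"
    using Rh by (auto simp: R_def)
  have hdeg: "degree h > 0"
  proof (rule ccontr)
    assume "\<not> degree h > 0"
    then obtain c where "h = [:c:]" by (metis degree_eq_zeroE neq0_conv)
    with h0 ha show False by (simp add: map_poly_pCons)
  qed
  obtain q r where qr: "pseudo_divmod F h = (q, r)" by fastforce
  define c where "c = coeff h (degree h) ^ (Suc (degree F) - degree h)"
  from pseudo_divmod[OF h0 qr] have eq: "smult c F = h * q + r"
    and r: "r = 0 \<or> degree r < degree h" by (auto simp: c_def)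
  have "poly (map_poly of_int (smult c F)) a = 0"
    using F(3) by (simp add: map_poly_smult)
  moreover have "(map_poly of_int (h * q + r) :: 'a poly) = map_poly of_int h * map_poly of_int q + map_poly of_int r"
    by (simp add: poly_eq_iff coeff_map_poly coeff_mult)
  ultimately have "poly (map_poly of_int r) a = 0" using eq ha by simp
  with r hmin[of r] have r0: "r = 0" unfolding R_def by (meson not_less)
  have c0: "c \<noteq> 0" using h0 by (simp add: c_def)
  have "prime_elem F" using F(1) by (simp add: prime_elem_iff_irreducible)
  moreover have "F dvd h * q" using eq r0 by (metis add_0_right dvd_smult dvd_refl)
  ultimately have "F dvd h \<or> F dvd q" by (simp add: prime_elem_dvd_mult_iff)
  then have "degree F \<le> degree h"
  proof
    assume "F dvd h"
    then show ?thesis using h0 by (rule dvd_imp_degree_le)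
  next
    assume Fq: "F dvd q"
    have F0: "F \<noteq> 0" using F(1) by auto
    have q0: "q \<noteq> 0" using eq r0 c0 F0 by auto
    have "degree F = degree h + degree q"
      using arg_cong[OF eq, of degree] r0 c0 h0 q0 by (simp add: degree_mult_eq)
    with dvd_imp_degree_le[OF Fq q0] hdeg show ?thesis by simp
  qed
  also have "\<dots> \<le> degree g" using hmin \<open>R g\<close> .
  finally show ?thesis .
qed

text \<open>The expansion of w^2 - w + 1 at w = X - X^2. It is polymorphic because it is used over
  the integers, modulo 2, and over the real and complex numbers.\<close>

definition quartic :: "'a::comm_ring_1 poly" where
  "quartic = [:1, -1, 2, -2, 1:]"

lemma degree_quartic [simp]: "degree (quartic :: 'a::comm_ring_1 poly) = 4"
  by (simp add: quartic_def)

lemma lead_coeff_quartic: "lead_coeff (quartic :: 'a::comm_ring_1 poly) = 1"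
  by (simp add: quartic_def eval_nat_numeral)

lemma monic_quartic_power:
  assumes "n > 0"
  shows "degree ((quartic :: int poly) ^ n + [:c:]) = 4 * n"
    and "lead_coeff ((quartic :: int poly) ^ n + [:c:]) = 1"
proof -
  have degQ: "degree ((quartic :: int poly) ^ n) = 4 * n" by (simp add: degree_power_eq quartic_def)
  show "degree ((quartic :: int poly) ^ n + [:c:]) = 4 * n"
    using assms degQ by (subst degree_add_eq_left) auto
  have "lead_coeff ((quartic :: int poly) ^ n) = 1" using lead_coeff_quartic[where 'a=int] by (simp add: lead_coeff_power del: degree_quartic)
  then show "lead_coeff ((quartic :: int poly) ^ n + [:c:]) = 1"
    using assms degQ \<open>degree (_ + _) = _\<close> by (simp add: coeff_eq_0)
qed
lemma bit_cases01: "(x::bit) = 0 \<or> x = 1" by (cases x) auto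

text \<open>Modulo 2 the polynomial is X^4 + X + 1. One of two factors has degree at most 2, which
  leaves finitely many coefficient vectors to check.\<close>

lemma irreducible_quartic_mod_2: "irreducible (quartic :: bit poly)"
proof (rule Factorial_Ring.irreducibleI)
  show "(quartic :: bit poly) \<noteq> 0" by (simp add: quartic_def)
  show "\<not> (quartic :: bit poly) dvd 1"
  proof
    assume "(quartic :: bit poly) dvd 1"
    then obtain c where "(quartic :: bit poly) = [:c:]" by (elim is_unit_polyE)
    from arg_cong[OF this, of degree] show False by simp
  qed
  fix f g :: "bit poly" assume fg: "quartic = f * g"
  have *: "is_unit f" if fg: "quartic = f * g" and le: "degree f \<le> 2" for f g :: "bit poly"
  proof -
    have "(quartic :: bit poly) \<noteq> 0" by (simp add: quartic_def)
    then have fn: "f \<noteq> 0" "g \<noteq> 0" using fg by auto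
    have deg: "degree f + degree g = 4"
      using fg degree_quartic[where 'a=bit] fn by (metis degree_mult_eq)
    define f0 f1 f2 where "f0 = coeff f 0" and "f1 = coeff f 1" and "f2 = coeff f 2"
    define g0 g1 g2 g3 g4 where "g0 = coeff g 0" and "g1 = coeff g 1" and "g2 = coeff g 2"
       and "g3 = coeff g 3" and "g4 = coeff g 4"
    have f: "f = [:f0, f1, f2:]"
      by (rule poly_eqI) (use le in \<open>auto simp: f0_def f1_def f2_def coeff_pCons numeral_2_eq_2 split: nat.splits intro!: coeff_eq_0\<close>)
    have g: "g = [:g0, g1, g2, g3, g4:]"
      by (rule poly_eqI) (use deg in \<open>auto simp: g0_def g1_def g2_def g3_def g4_def coeff_pCons eval_nat_numeral split: nat.splits intro!: coeff_eq_0\<close>)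
    have fg': "[:1, 1, 0, 0, 1:] = f * g" using fg by (simp add: quartic_def)
    \<comment> \<open>All 2^8 choices of the three coefficients of \<open>f\<close> and the five of
      \<open>g\<close> are compared with \<open>fg'\<close>; the surviving ones have constant
      \<open>f\<close>.\<close>
    have "f1 = 0 \<and> f2 = 0"
      using bit_cases01[of f0] bit_cases01[of f1] bit_cases01[of f2] bit_cases01[of g0]
        bit_cases01[of g1] bit_cases01[of g2] bit_cases01[of g3] bit_cases01[of g4] fg'
      unfolding f g by (elim disjE) simp_all
    with f have "f = [:f0:]" by simp
    with fn show ?thesis by (metis is_unit_const_poly_iff dvd_field_iff pCons_0_0)
  qed
  have "degree f + degree g = 4"
    using fg degree_quartic[where 'a=bit] by (metis degree_mult_eq degree_0 mult_zero_left mult_zero_right zero_neq_numeral)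
  then have "degree f \<le> 2 \<or> degree g \<le> 2" by linarith
  then show "f dvd 1 \<or> g dvd 1" using *[of f g] *[of g f] fg by (auto simp: mult.commute)
qed

lemma prime_quartic_mod_2: "prime_elem (quartic :: bit poly)"
  by (rule field_poly_irreducible_imp_prime) (rule irreducible_quartic_mod_2)

lemma bit_poly_unit: "is_unit (u :: bit poly) \<Longrightarrow> u = 1"
  by (metis bit_cases01 is_unit_polyE one_pCons dvd_0_left_iff zero_neq_one)

text \<open>Unique factorization, by cancelling one prime factor at a time. Over the field with two
  elements 1 is the only unit, so the factors are powers of \<open>quartic\<close> on the
  nose.\<close>

lemma factor_of_power_mod_2:
  assumes "f * g = (quartic :: bit poly) ^ n"
  shows "\<exists>a b. a + b = n \<and> f = quartic ^ a \<and> g = quartic ^ b"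
  using assms
proof (induction n arbitrary: f g)
  case 0
  then have "is_unit f" "is_unit g" by (metis dvd_triv_left power_0, metis dvd_triv_right power_0)
  then show ?case using bit_poly_unit[of f] bit_poly_unit[of g] by auto
next
  case (Suc n)
  have q0: "(quartic :: bit poly) \<noteq> 0" by (simp add: quartic_def)
  have "quartic dvd f * g" using Suc.prems by simp
  then have "quartic dvd f \<or> quartic dvd g" using prime_quartic_mod_2 by (simp add: prime_elem_dvd_mult_iff)
  then show ?case
  proof
    assume "quartic dvd f"
    then obtain f' where f: "f = quartic * f'" by (elim dvdE)
    have "f' * g = quartic ^ n" using Suc.prems q0 unfolding f by (simp add: mult.assoc)
    from Suc.IH[OF this] obtain a b where "a + b = n" "f' = quartic ^ a" "g = quartic ^ b" by auto
    then show ?thesis unfolding f by (intro exI[of _ "Suc a"] exI[of _ b]) auto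
  next
    assume "quartic dvd g"
    then obtain g' where g: "g = quartic * g'" by (elim dvdE)
    have "f * g' = quartic ^ n" using Suc.prems q0 unfolding g by (simp add: mult.left_commute)
    from Suc.IH[OF this] obtain a b where "a + b = n" "f = quartic ^ a" "g' = quartic ^ b" by auto
    then show ?thesis unfolding g by (intro exI[of _ a] exI[of _ "Suc b"]) auto
  qed
qed

abbreviation red2 :: "int poly \<Rightarrow> bit poly" where "red2 \<equiv> map_poly of_int"

lemma red2_hom:
  "red2 (f + g) = red2 f + red2 g" "red2 (f * g) = red2 f * red2 g" "red2 (f ^ k) = red2 f ^ k"
proof -
  show add: "red2 (f + g) = red2 f + red2 g" for f g by (simp add: poly_eq_iff coeff_map_poly)
  show mult: "red2 (f * g) = red2 f * red2 g" for f g by (simp add: poly_eq_iff coeff_map_poly coeff_mult)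
  show "red2 (f ^ k) = red2 f ^ k" by (induction k) (auto simp: mult)
qed

lemma red2_quartic: "red2 quartic = quartic"
  by (simp add: quartic_def map_poly_pCons)

lemma of_int_bit_eq_0_iff: "(of_int k :: bit) = 0 \<longleftrightarrow> even k"
  by (metis even_of_int_iff bit_not_zero_iff even_zero odd_one)

lemma red2_eq_0D: "red2 u = 0 \<Longrightarrow> \<exists>v. u = smult 2 v"
proof -
  assume "red2 u = 0"
  then have "\<forall>i. 2 dvd coeff u i" by (metis coeff_map_poly of_int_0 coeff_0 of_int_bit_eq_0_iff)
  then have "[:2:] dvd u" by (simp add: const_poly_dvd_iff)
  then show ?thesis by (auto elim!: dvdE)
qed

lemma monic_nonunit_degree:
  fixes f :: "int poly" assumes "lead_coeff f dvd 1" "\<not> f dvd 1" shows "degree f > 0"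
proof (rule ccontr)
  assume "\<not> degree f > 0"
  then obtain c where "f = [:c:]" by (metis degree_eq_zeroE neq0_conv)
  with assms show False by (simp add: is_unit_const_poly_iff)
qed

text \<open>Schoenemann's criterion: modulo 2 both factors would be powers of the irreducible \<open>quartic\<close>, which
  would then divide the odd number \<open>k\<close>.\<close>

lemma irreducible_quartic_power:
  assumes k: "odd k" and n: "n > 0"
  shows "irreducible ((quartic :: int poly) ^ n + [:2 * k:])" (is "irreducible ?P")
proof (rule Factorial_Ring.irreducibleI)
  note degP = monic_quartic_power(1)[OF n, of "2 * k"] and lcP = monic_quartic_power(2)[OF n, of "2 * k"]
  show "?P \<noteq> 0" using degP n by auto
  show "\<not> ?P dvd 1" using degP n by (auto elim!: is_unit_polyE)
  fix f g :: "int poly" assume fg: "?P = f * g"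
  show "f dvd 1 \<or> g dvd 1"
  proof (rule ccontr)
    assume "\<not> ?thesis"
    then have nu: "\<not> f dvd 1" "\<not> g dvd 1" by auto
    have "lead_coeff f * lead_coeff g = 1" using lcP fg by (simp add: lead_coeff_mult)
    then have lc: "lead_coeff f dvd 1" "lead_coeff g dvd 1" by (metis dvd_triv_left, metis dvd_triv_right)
    have df: "degree f > 0" "degree g > 0" using monic_nonunit_degree lc nu by auto
    have "red2 f * red2 g = quartic ^ n"
      using arg_cong[OF fg, of red2] by (simp add: red2_hom red2_quartic map_poly_pCons)
    then obtain a b where ab: "a + b = n" "red2 f = quartic ^ a" "red2 g = quartic ^ b"
      using factor_of_power_mod_2 by blast
    \<comment> \<open>The leading coefficients are units, hence odd, so they survive reduction. This
      is what makes both exponents \<open>a\<close> and \<open>b\<close> positive.\<close>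
    have deg_red: "degree (red2 h) = degree h" if "lead_coeff h dvd 1" for h
      using that by (intro map_poly_degree_eq) (use odd_one[where 'a=int] dvd_trans of_int_bit_eq_0_iff in blast)
    have "a > 0" using ab(2) deg_red[OF lc(1)] df by (cases a) auto
    have "b > 0" using ab(3) deg_red[OF lc(2)] df by (cases b) auto
    have "red2 (f - quartic ^ a) = 0" "red2 (g - quartic ^ b) = 0"
      using red2_hom(1)[of "f - quartic ^ a" "quartic ^ a"] red2_hom(1)[of "g - quartic ^ b" "quartic ^ b"] ab
      by (simp_all add: red2_hom(3) red2_quartic)
    then obtain u v where "f - quartic ^ a = smult 2 u" "g - quartic ^ b = smult 2 v"
      using red2_eq_0D by meson
    then have uv: "f = quartic ^ a + smult 2 u" "g = quartic ^ b + smult 2 v" by (auto simp: algebra_simps)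
    \<comment> \<open>The powers \<open>quartic ^ n\<close> cancel in \<open>fg\<close>. What
      remains is divisible by 2, and the quotient is reduced modulo 2 once more.\<close>
    have "smult 2 [:k:] = smult 2 (quartic ^ a * v + u * quartic ^ b + smult 2 (u * v))"
      using fg unfolding uv ab(1)[symmetric] by (simp add: algebra_simps power_add smult_add_right)
    then have "[:k:] = quartic ^ a * v + u * quartic ^ b + smult 2 (u * v)"
      by (metis smult_cancel zero_neq_numeral)
    from arg_cong[OF this, of red2]
    have "red2 [:k:] = quartic ^ a * red2 v + red2 u * quartic ^ b"
      by (simp add: red2_hom red2_quartic map_poly_smult)
    moreover have "red2 [:k:] = 1" using k of_int_bit_eq_0_iff[of k]
      by (simp add: map_poly_pCons one_pCons)
    moreover have "quartic dvd (quartic ^ a * red2 v + red2 u * quartic ^ b :: bit poly)"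
      using \<open>a > 0\<close> \<open>b > 0\<close> by (intro dvd_add dvd_mult dvd_mult2) (auto intro: dvd_power)
    ultimately have "(quartic :: bit poly) dvd 1" by simp
    then show False using irreducible_quartic_mod_2 by (simp add: irreducible_not_unit)
  qed
qed

section \<open>The number field generated by a root\<close>

text \<open>One rational polynomial \<open>f\<close> encodes the field element
  \<open>ev f \<alpha>\<close> together with its conjugates \<open>ev f \<rho>\<close> at the other
  roots.\<close>

abbreviation ev :: "rat poly \<Rightarrow> complex \<Rightarrow> complex" where
  "ev f x \<equiv> poly (map_poly of_rat f) x"

lemma map_poly_of_rat_mult: "map_poly of_rat (f * g) = (map_poly of_rat f * map_poly of_rat g :: complex poly)"
  by (simp add: poly_eq_iff coeff_map_poly coeff_mult of_rat_sum of_rat_mult)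

lemma ev_simps [simp]:
  "ev (f + g) x = ev f x + ev g x" "ev (f - g) x = ev f x - ev g x" "ev (- f) x = - ev f x"
  "ev (f * g) x = ev f x * ev g x" "ev (pCons a f) x = of_rat a + x * ev f x"
  "ev (smult a f) x = of_rat a * ev f x"
proof -
  have "map_poly of_rat (f + g) = (map_poly of_rat f + map_poly of_rat g :: complex poly)"
    by (simp add: poly_eq_iff coeff_map_poly of_rat_add)
  then show "ev (f + g) x = ev f x + ev g x" by simp
  have "map_poly of_rat (f - g) = (map_poly of_rat f - map_poly of_rat g :: complex poly)"
    by (simp add: poly_eq_iff coeff_map_poly of_rat_diff)
  then show "ev (f - g) x = ev f x - ev g x" by simp
  have "map_poly of_rat (- f) = (- map_poly of_rat f :: complex poly)"
    by (simp add: poly_eq_iff coeff_map_poly of_rat_minus)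
  then show "ev (- f) x = - ev f x" by simp
  show "ev (f * g) x = ev f x * ev g x" by (simp add: map_poly_of_rat_mult)
  show "ev (pCons a f) x = of_rat a + x * ev f x" by (simp add: map_poly_pCons)
  show "ev (smult a f) x = of_rat a * ev f x" by (simp add: map_poly_smult of_rat_mult)
qed

lemma ev_monom [simp]: "ev (Polynomial.monom a n) x = of_rat a * x ^ n"
  by (simp add: map_poly_monom poly_monom)

lemma ev_power [simp]: "ev (f ^ n) x = ev f x ^ n"
  by (induction n) auto

lemma ev_of_int_poly: "ev (map_poly of_int f) x = poly (map_poly of_int f) x"
  by (simp add: map_poly_map_poly o_def)

lemma cnj_of_rat [simp]: "cnj (of_rat q) = of_rat q"
  by (cases q) (simp add: of_rat_rat)

lemma ev_cnj: "ev f (cnj x) = cnj (ev f x)"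
  by (induction f) auto

lemma clear_denominators:
  fixes f :: "rat poly"
  shows "\<exists>(c::int) g. c \<noteq> 0 \<and> map_poly of_int g = smult (of_int c) f"
proof (induction f)
  case 0
  show ?case by (intro exI[of _ 1] exI[of _ 0]) auto
next
  case (pCons a f)
  then obtain c g where c: "c \<noteq> 0" "map_poly of_int g = smult (of_int c) f" by auto
  obtain r s where rs: "quotient_of a = (r, s)" by fastforce
  then have s: "s > 0" and a: "a = of_int r / of_int s"
    using quotient_of_denom_pos quotient_of_div by auto
  have "map_poly of_int (pCons (c * r) (smult s g)) = smult (of_int (c * s)) (pCons a f)"
    using s c by (simp add: map_poly_pCons map_poly_smult a mult_ac)
  then show ?case using c s by (intro exI[of _ "c * s"]) auto
qed

locale number_field_generator =
  fixes P :: "int poly" and \<alpha> :: complex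
  assumes irr: "Factorial_Ring.irreducible P"
    and monic: "lead_coeff P = 1"
    and root: "poly (map_poly of_int P) \<alpha> = 0"
begin

definition is_root :: "complex \<Rightarrow> bool" where "is_root \<rho> \<longleftrightarrow> poly (map_poly of_int P) \<rho> = 0"

lemma is_root_generator: "is_root \<alpha>" using root by (simp add: is_root_def)

definition PQ :: "rat poly" where "PQ = map_poly of_int P"

lemma degree_PQ [simp]: "degree PQ = degree P"
  unfolding PQ_def by (rule degree_map_poly) auto

lemma PQ_nonzero: "PQ \<noteq> 0"
  using irr degree_PQ by (auto simp: PQ_def map_poly_eq_0_iff)

lemma ev_PQ: "ev PQ x = poly (map_poly of_int P) x"
  by (simp add: PQ_def ev_of_int_poly)

lemma degree_pos: "degree P > 0"
proof (rule ccontr)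
  assume "\<not> degree P > 0"
  then obtain c where "P = [:c:]" by (metis degree_eq_zeroE neq0_conv)
  with root monic show False by (simp add: map_poly_pCons)
qed

lemma min_degree:
  assumes "is_root \<rho>" "f \<noteq> 0" "ev f \<rho> = 0"
  shows "degree P \<le> degree f"
proof -
  obtain c g where c: "c \<noteq> 0" and g: "map_poly of_int g = smult (of_int c) f"
    using clear_denominators by blast
  have "ev (map_poly of_int g) \<rho> = 0" using assms(3) unfolding g by simp
  then have "poly (map_poly of_int g) \<rho> = 0" by (simp add: ev_of_int_poly)
  moreover have "g \<noteq> 0" using g c assms(2) by auto
  ultimately have "degree P \<le> degree g"
    using irreducible_int_poly_min_degree[OF irr degree_pos _ \<open>g \<noteq> 0\<close>, of \<rho>] assms(1)
    by (simp add: is_root_def)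
  moreover have "degree (map_poly of_int g :: rat poly) = degree g" by (rule degree_map_poly) auto
  ultimately show ?thesis using c by (simp add: g)
qed

lemma ev_eq_0_iff: "is_root \<rho> \<Longrightarrow> ev f \<rho> = 0 \<longleftrightarrow> PQ dvd f"
proof
  assume \<rho>: "is_root \<rho>" and f: "ev f \<rho> = 0"
  have "f = PQ * (f div PQ) + f mod PQ" by simp
  then have "ev f \<rho> = ev PQ \<rho> * ev (f div PQ) \<rho> + ev (f mod PQ) \<rho>" by (metis ev_simps(1,4))
  then have "ev (f mod PQ) \<rho> = 0" using f \<rho> by (simp add: ev_PQ is_root_def)
  then have "f mod PQ = 0" using min_degree[OF \<rho>, of "f mod PQ"] degree_mod_less[OF PQ_nonzero, of f] by force
  then show "PQ dvd f" by (simp add: mod_eq_0_iff_dvd)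
next
  assume \<rho>: "is_root \<rho>" and "PQ dvd f"
  then obtain g where "f = PQ * g" by (elim dvdE)
  then show "ev f \<rho> = 0" using \<rho> by (simp add: ev_PQ is_root_def)
qed

text \<open>At every root the kernel of evaluation is generated by \<open>PQ\<close>, so rational
  relations transfer between roots. The embeddings of the field are well defined and injective for
  this reason.\<close>

lemma ev_eq_iff: "is_root \<rho> \<Longrightarrow> is_root \<sigma> \<Longrightarrow> ev f \<rho> = ev g \<rho> \<longleftrightarrow> ev f \<sigma> = ev g \<sigma>"
  using ev_eq_0_iff[of \<rho> "f - g"] ev_eq_0_iff[of \<sigma> "f - g"] by simp

lemma finite_roots: "finite {\<rho>. is_root \<rho>}"
proof -
  have "map_poly of_int P \<noteq> (0 :: complex poly)" using irr by (auto simp: map_poly_eq_0_iff)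
  then show ?thesis unfolding is_root_def by (rule poly_roots_finite)
qed

text \<open>The derivative is nonzero of smaller degree, so by minimality it vanishes at no root of
  \<open>P\<close> and all roots are simple. This links the places, indexed by a set of roots, with
  Mahler measures, which count multiplicities.\<close>

lemma proots_eq: "proots (map_poly of_int P :: complex poly) = mset_set {\<rho>. is_root \<rho>}"
proof (rule multiset_eqI)
  fix x
  have nz: "map_poly of_int P \<noteq> (0 :: complex poly)" using irr by (auto simp: map_poly_eq_0_iff)
  show "count (proots (map_poly of_int P)) x = count (mset_set {\<rho>. is_root \<rho>}) x"
  proof (cases "is_root x")
    case True
    have "ev (pderiv PQ) x \<noteq> 0"
    proof
      assume "ev (pderiv PQ) x = 0"
      moreover have "pderiv PQ \<noteq> 0" using degree_pos by (simp add: pderiv_eq_0_iff)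
      ultimately have "degree P \<le> degree (pderiv PQ)" using min_degree True by blast
      then show False using degree_pos by (simp add: degree_pderiv)
    qed
    moreover have "ev (pderiv PQ) x = poly (pderiv (map_poly of_int P)) x"
    proof -
      have "(map_poly of_rat (pderiv PQ) :: complex poly) = pderiv (map_poly of_int P)"
        by (simp add: poly_eq_iff coeff_map_poly coeff_pderiv PQ_def of_rat_mult)
           (metis of_rat_of_nat_eq of_rat_of_int_eq of_rat_mult of_rat_add of_rat_1)
      then show ?thesis by simp
    qed
    ultimately have "poly (pderiv (map_poly of_int P)) x \<noteq> 0" by simp
    moreover have "order x (map_poly of_int P) \<noteq> 0" using True nz by (simp add: is_root_def order_root)
    ultimately have "order x (map_poly of_int P) = 1"
      using order_pderiv[of "map_poly of_int P" x] order_root[of "pderiv (map_poly of_int P)" x] nz True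
      by (auto simp: is_root_def)
    then show ?thesis using True nz finite_roots by simp
  next
    case False
    then show ?thesis using nz finite_roots by (simp add: is_root_def order_root)
  qed
qed

definition K :: "complex set" where "K = range (\<lambda>f. ev f \<alpha>)"

lemma ev_in_K [simp]: "ev f \<alpha> \<in> K" by (auto simp: K_def)

lemma K_cases: "x \<in> K \<Longrightarrow> (\<And>f. x = ev f \<alpha> \<Longrightarrow> thesis) \<Longrightarrow> thesis" by (auto simp: K_def)

lemma K_rat [simp]: "of_rat q \<in> K" using ev_in_K[of "[:q:]"] by simp

lemma K_0 [simp]: "0 \<in> K" and K_1 [simp]: "1 \<in> K" and K_gen [simp]: "\<alpha> \<in> K"
  using K_rat[of 0] K_rat[of 1] ev_in_K[of "[:0, 1:]"] by simp_all

lemma K_add [simp]: "x \<in> K \<Longrightarrow> y \<in> K \<Longrightarrow> x + y \<in> K"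
  and K_diff [simp]: "x \<in> K \<Longrightarrow> y \<in> K \<Longrightarrow> x - y \<in> K"
  and K_minus [simp]: "x \<in> K \<Longrightarrow> - x \<in> K"
  and K_mult [simp]: "x \<in> K \<Longrightarrow> y \<in> K \<Longrightarrow> x * y \<in> K"
  by (elim K_cases, metis ev_simps ev_in_K)+

text \<open>Bezout for \<open>f\<close> and \<open>PQ\<close>. Their gcd \<open>g\<close> is
  constant: in \<open>PQ = g * h\<close> the factor \<open>g\<close> does not vanish at
  \<open>\<alpha>\<close>, so \<open>h\<close> does and has full degree.\<close>

lemma K_inverse [simp]: assumes "x \<in> K" shows "inverse x \<in> K"
proof (cases "x = 0")
  case False
  obtain f where f: "x = ev f \<alpha>" using assms K_cases by blast
  define g where "g = gcd f PQ"
  obtain u v where uv: "u * f + v * PQ = g"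
    using bezout_coefficients_fst_snd[of f PQ] unfolding g_def by blast
  have "\<not> PQ dvd f" using False f ev_eq_0_iff[OF is_root_generator] by simp
  moreover have "g dvd f" "g dvd PQ" by (auto simp: g_def)
  ultimately have "\<not> PQ dvd g" by (meson dvd_trans)
  obtain h where h: "PQ = g * h" using \<open>g dvd PQ\<close> by (elim dvdE)
  have "ev g \<alpha> * ev h \<alpha> = 0" using root by (simp flip: ev_simps h add: ev_PQ)
  then have "PQ dvd h" using \<open>\<not> PQ dvd g\<close> ev_eq_0_iff[OF is_root_generator] by auto
  then have "degree PQ \<le> degree h" using h PQ_nonzero by (intro dvd_imp_degree_le) auto
  then have "degree g = 0" using h PQ_nonzero by (auto simp: degree_mult_eq)
  then obtain c where c: "g = [:c:]" by (metis degree_eq_zeroE)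
  have "c \<noteq> 0" using h PQ_nonzero c by auto
  have "ev u \<alpha> * x = of_rat c"
    using arg_cong[OF uv, of "\<lambda>p. ev p \<alpha>"] root by (simp add: f c ev_PQ)
  then have "inverse x = ev (smult (inverse c) u) \<alpha>"
    using False \<open>c \<noteq> 0\<close> by (simp add: of_rat_inverse of_rat_divide field_simps)
  then show ?thesis by simp
qed auto

lemma K_power [simp]: "x \<in> K \<Longrightarrow> x ^ n \<in> K"
  by (induction n) auto

lemma K_sum: "(\<And>i. i \<in> A \<Longrightarrow> f i \<in> K) \<Longrightarrow> sum f A \<in> K"
  by (induction A rule: infinite_finite_induct) auto

end

lemma complex_field_simps [simp]:
  "carrier complex_field = UNIV" "x \<otimes>\<^bsub>complex_field\<^esub> y = x * y" "x \<oplus>\<^bsub>complex_field\<^esub> y = x + y"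
  "\<one>\<^bsub>complex_field\<^esub> = 1" "\<zero>\<^bsub>complex_field\<^esub> = 0"
  by (simp_all add: ring_of_type_algebra_def)

interpretation complex_field: cring complex_field
  by (rule cring_from_type_algebra)

lemma complex_field_a_inv [simp]: "\<ominus>\<^bsub>complex_field\<^esub> x = - x"
  by (rule complex_field.minus_equality) auto

lemma complex_field_m_inv [simp]: "x \<noteq> 0 \<Longrightarrow> inv\<^bsub>complex_field\<^esub> x = inverse x"
  by (rule complex_field.comm_inv_char) auto

lemma subfield_complexI:
  assumes "1 \<in> S" "\<And>x y. x \<in> S \<Longrightarrow> y \<in> S \<Longrightarrow> x + y \<in> S" "\<And>x y. x \<in> S \<Longrightarrow> y \<in> S \<Longrightarrow> x * y \<in> S"
    "\<And>x. x \<in> S \<Longrightarrow> - x \<in> S" "\<And>x. x \<in> S \<Longrightarrow> inverse x \<in> S"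
  shows "subfield S complex_field"
proof (rule field.subfieldI'[OF field_from_type_algebra])
  show "subring S complex_field"
    by (rule complex_field.subringI) (use assms in auto)
qed (use assms in auto)

lemma subfield_Rats: "subfield \<rat> complex_field"
  by (rule subfield_complexI) auto

context number_field_generator
begin

lemma generate_field_eq: "generate_field complex_field {\<alpha>} = K"
proof
  have "subfield K complex_field" by (rule subfield_complexI) auto
  then show "generate_field complex_field {\<alpha>} \<subseteq> K"
    by (intro field.generate_field_min_subfield1[OF field_from_type_algebra]) auto
  define G where "G = generate_field complex_field {\<alpha>}"
  have one: "1 \<in> G" and gen: "\<alpha> \<in> G"
    using generate_field.one[of complex_field "{\<alpha>}"] generate_field.incl[of \<alpha> "{\<alpha>}" complex_field]
    by (auto simp: G_def)
  have add: "x + y \<in> G" and mult: "x * y \<in> G" if "x \<in> G" "y \<in> G" for x y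
    using that generate_field.eng_add[of x complex_field _ y] generate_field.eng_mult[of x complex_field _ y]
    by (auto simp: G_def)
  have neg: "- x \<in> G" if "x \<in> G" for x
    using that generate_field.a_inv[of x complex_field] by (auto simp: G_def)
  have zero: "0 \<in> G" using add[OF one neg[OF one]] by simp
  have inv: "inverse x \<in> G" if "x \<in> G" for x
    using that zero generate_field.m_inv[of x complex_field] by (cases "x = 0") (auto simp: G_def)
  have nat: "of_nat n \<in> G" for n by (induction n) (auto intro: zero add one)
  have int: "of_int n \<in> G" for n
    using nat neg by (cases n rule: int_cases2) auto
  have rat: "of_rat q \<in> G" for q
    using mult[OF int inv[OF int], of "fst (quotient_of q)" "snd (quotient_of q)"]
    by (cases "quotient_of q") (auto simp: of_rat_divide of_rat_mult of_rat_inverse divide_inverse dest!: quotient_of_div)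
  have "ev f \<alpha> \<in> G" for f
    by (induction f) (auto intro: zero add mult rat gen)
  then show "K \<subseteq> generate_field complex_field {\<alpha>}" by (auto simp: K_def G_def)
qed

lemma dim_K: "ring.dim complex_field \<rat> K = degree P"
proof -
  \<comment> \<open>\<open>E k\<close> is the rational span of the powers of \<open>\<alpha>\<close>
    with exponent below \<open>k\<close>. As long as \<open>k < degree P\<close>, the next power is
    independent of it by \<open>min_degree\<close>.\<close>
  define E where "E = (\<lambda>k. {ev f \<alpha> |f. \<forall>i\<ge>k. coeff f i = 0})"
  have "complex_field.dimension k \<rat> (E k)" if "k \<le> degree P" for k
    using that
  proof (induction k)
    case 0
    have "E 0 = {0}"
    proof -
      have "(\<forall>i\<ge>0. coeff f i = 0) \<longleftrightarrow> f = 0" for f :: "rat poly" by (simp add: poly_eq_iff)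
      then show ?thesis by (simp add: E_def)
    qed
    then show ?case using complex_field.zero_dim[of \<rat>] by simp
  next
    case (Suc k)
    have "\<alpha> ^ k \<notin> E k"
    proof
      assume "\<alpha> ^ k \<in> E k"
      then obtain f where f: "\<forall>i\<ge>k. coeff f i = 0" "\<alpha> ^ k = ev f \<alpha>" by (auto simp: E_def)
      define g where "g = Polynomial.monom 1 k - f"
      have g: "coeff g k = 1" "\<And>i. i > k \<Longrightarrow> coeff g i = 0" using f by (auto simp: g_def)
      have "g \<noteq> 0" "ev g \<alpha> = 0" using g(1) f(2) by (auto simp: g_def)
      then have "degree P \<le> degree g" using min_degree[OF is_root_generator] by blast
      moreover have "degree g \<le> k" using g(2) by (intro degree_le) auto
      ultimately show False using Suc.prems by simp
    qed
    moreover have "complex_field.dimension k \<rat> (E k)" using Suc by simp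
    ultimately have "complex_field.dimension (Suc k) \<rat> (complex_field.line_extension \<rat> (\<alpha> ^ k) (E k))"
      by (intro complex_field.Suc_dim) auto
    also have "complex_field.line_extension \<rat> (\<alpha> ^ k) (E k) = E (Suc k)"
    proof (intro subset_antisym subsetI)
      fix x assume "x \<in> complex_field.line_extension \<rat> (\<alpha> ^ k) (E k)"
      then obtain a f where "x = a * \<alpha> ^ k + ev f \<alpha>" "a \<in> \<rat>" "\<forall>i\<ge>k. coeff f i = 0"
        by (auto simp: complex_field.line_extension_mem_iff E_def)
      moreover then obtain q where "a = of_rat q" by (auto elim: Rats_cases)
      ultimately show "x \<in> E (Suc k)"
        unfolding E_def by (intro CollectI exI[of _ "Polynomial.monom q k + f"]) auto
    next
      fix x assume "x \<in> E (Suc k)"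
      then obtain f where f: "x = ev f \<alpha>" "\<forall>i\<ge>Suc k. coeff f i = 0" by (auto simp: E_def)
      define g where "g = f - Polynomial.monom (coeff f k) k"
      have "\<forall>i\<ge>k. coeff g i = 0" 
      proof (intro allI impI)
        fix i assume "k \<le> i"
        then show "coeff g i = 0" using f(2) by (cases "i = k") (auto simp: g_def)
      qed
      then have "ev g \<alpha> \<in> E k" by (auto simp: E_def)
      moreover have "x = of_rat (coeff f k) * \<alpha> ^ k + ev g \<alpha>" by (simp add: g_def f(1))
      ultimately show "x \<in> complex_field.line_extension \<rat> (\<alpha> ^ k) (E k)"
        by (auto simp: complex_field.line_extension_mem_iff)
    qed
    finally show ?case .
  qed
  then have "complex_field.dimension (degree P) \<rat> (E (degree P))" by simp
  moreover have "E (degree P) = K"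
  proof
    show "E (degree P) \<subseteq> K" by (auto simp: E_def)
    show "K \<subseteq> E (degree P)"
    proof
      fix x assume "x \<in> K"
      then obtain f where f: "x = ev f \<alpha>" by (rule K_cases)
      have "f = PQ * (f div PQ) + f mod PQ" by simp
      then have "ev f \<alpha> = ev PQ \<alpha> * ev (f div PQ) \<alpha> + ev (f mod PQ) \<alpha>" by (metis ev_simps(1,4))
      then have "x = ev (f mod PQ) \<alpha>" using f root by (simp add: ev_PQ)
      moreover have "\<forall>i\<ge>degree P. coeff (f mod PQ) i = 0"
        using degree_mod_less[OF PQ_nonzero, of f] by (auto intro: coeff_eq_0)
      ultimately show "x \<in> E (degree P)" by (auto simp: E_def)
    qed
  qed
  ultimately show ?thesis using complex_field.dimI[OF subfield_Rats] by (simp add: over_def)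
qed

end

section \<open>Places of a totally complex number field\<close>

locale abs_value =
  fixes K :: "complex set" and v :: "complex \<Rightarrow> real"
  assumes av: "absolute_value K v"
begin

lemma nonneg: "x \<in> K \<Longrightarrow> 0 \<le> v x"
  and eq_0: "x \<in> K \<Longrightarrow> v x = 0 \<longleftrightarrow> x = 0"
  and mult: "x \<in> K \<Longrightarrow> y \<in> K \<Longrightarrow> v (x * y) = v x * v y"
  and add: "x \<in> K \<Longrightarrow> y \<in> K \<Longrightarrow> v (x + y) \<le> v x + v y"
  using av by (simp_all add: absolute_value_def)

end

locale number_field_place = number_field_generator P \<alpha> + abs_value "number_field_generator.K \<alpha>" v
  for P \<alpha> v
begin

lemma v_1 [simp]: "v 1 = 1"
  using mult[of 1 1] eq_0[of 1] by simp

lemma v_0 [simp]: "v 0 = 0"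
  using eq_0[of 0] by simp

lemma v_minus [simp]: "x \<in> K \<Longrightarrow> v (- x) = v x"
proof -
  assume x: "x \<in> K"
  have "v (- 1) * v (- 1) = 1" using mult[of "- 1" "- 1"] by simp
  then have "v (- 1) = 1" using nonneg[of "- 1"] by (simp add: square_eq_1_iff)
  then show "v (- x) = v x" using mult[of "- 1" x] x by simp
qed

lemma v_power: "x \<in> K \<Longrightarrow> v (x ^ n) = v x ^ n"
  by (induction n) (auto simp: mult)

lemma v_sum: "(\<And>i. i \<in> A \<Longrightarrow> f i \<in> K) \<Longrightarrow> v (sum f A) \<le> (\<Sum>i\<in>A. v (f i))"
proof (induction A rule: infinite_finite_induct)
  case (insert x A)
  then have "v (f x + sum f A) \<le> v (f x) + v (sum f A)" by (intro add K_sum) auto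
  then show ?case using insert by force
qed auto

lemma v_diff: "x \<in> K \<Longrightarrow> y \<in> K \<Longrightarrow> \<bar>v x - v y\<bar> \<le> v (x - y)"
  using add[of "x - y" y] add[of "y - x" x] v_minus[of "x - y"] by simp

abbreviation V :: "rat poly \<Rightarrow> real" where "V f \<equiv> v (ev f \<alpha>)"

lemma ev_altdef:
  assumes "degree f \<le> n"
  shows "ev f x = (\<Sum>i\<le>n. of_rat (coeff f i) * x ^ i)"
proof -
  have "degree (map_poly of_rat f :: complex poly) \<le> n"
    using map_poly_degree_leq[of "of_rat :: rat \<Rightarrow> complex" f] assms by simp
  moreover have "coeff (map_poly of_rat f :: complex poly) i = of_rat (coeff f i)" for i
    by (simp add: coeff_map_poly)
  moreover have "coeff (map_poly of_rat f :: complex poly) i = 0"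
    if "i > degree (map_poly of_rat f :: complex poly)" for i
    using that by (rule coeff_eq_0)
  ultimately show ?thesis unfolding poly_altdef
    by (intro sum.mono_neutral_cong_left) (auto simp: not_le)
qed

lemma V_le:
  assumes "degree f \<le> n"
  shows "V f \<le> (\<Sum>i\<le>n. v (of_rat (coeff f i)) * v \<alpha> ^ i)"
proof -
  have "V f = v (\<Sum>i\<le>n. of_rat (coeff f i) * \<alpha> ^ i)" by (simp add: ev_altdef[OF assms])
  also have "\<dots> \<le> (\<Sum>i\<le>n. v (of_rat (coeff f i) * \<alpha> ^ i))" by (rule v_sum) auto
  also have "\<dots> = (\<Sum>i\<le>n. v (of_rat (coeff f i)) * v \<alpha> ^ i)" by (simp add: mult v_power)
  finally show ?thesis .
qed

end

section \<open>Integrality at the nonarchimedean places\<close>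

lemma powers_bounded_imp_le_1:
  fixes x :: real
  assumes "\<And>n::nat. x ^ n \<le> C"
  shows "x \<le> 1"
proof (rule ccontr)
  assume "\<not> x \<le> 1"
  then obtain n where "C < x ^ n" using real_arch_pow[of x C] by auto
  with assms[of n] show False by simp
qed

lemma padic_abs_int_le_1: "prime (p::nat) \<Longrightarrow> padic_abs p (of_int k) \<le> 1"
proof -
  assume p: "prime p"
  then have "real p \<ge> 1" using prime_ge_1_nat[of p] by simp
  then have "inverse (real p ^ n) \<le> 1" for n by (simp add: field_simps)
  then show ?thesis by (simp add: padic_abs_def power_int_minus)
qed

context number_field_place
begin

text \<open>Pseudo-division by a monic polynomial is genuine division, so the remainder has integer
  coefficients.\<close>

lemma integral_powers: "\<exists>r. degree r < degree P \<and> \<alpha> ^ n = poly (map_poly of_int r) \<alpha>"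
proof -
  obtain q r where qr: "pseudo_divmod (Polynomial.monom 1 n) P = (q, r)" by fastforce
  have P0: "P \<noteq> 0" using irr by auto
  from pseudo_divmod[OF P0 qr] monic degree_pos
  have eq: "Polynomial.monom 1 n = P * q + r" and r: "degree r < degree P" by auto
  have "(Polynomial.monom 1 n :: complex poly) = map_poly of_int (P * q + r)"
    using eq by (metis map_poly_monom of_int_0 of_int_1)
  also have "\<dots> = map_poly of_int P * map_poly of_int q + map_poly of_int r"
    by (simp add: poly_eq_iff coeff_map_poly coeff_mult)
  finally have "poly (Polynomial.monom 1 n) \<alpha> = poly (map_poly of_int r) \<alpha>" using root by simp
  with r show ?thesis by (auto simp: poly_monom)
qed

text \<open>The powers of an algebraic integer lie in a finitely generated group, hence they are bounded.\<close>

lemma nonarchimedean_le_1: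
  assumes "prime p" and vp: "\<And>q. v (of_rat q) = padic_abs p q"
  shows "v \<alpha> \<le> 1"
proof (rule powers_bounded_imp_le_1)
  fix n
  obtain r where r: "degree r < degree P" "\<alpha> ^ n = poly (map_poly of_int r) \<alpha>"
    using integral_powers by blast
  have "v \<alpha> ^ n = V (map_poly of_int r)" using r(2) by (simp add: v_power[symmetric] ev_of_int_poly)
  also have "\<dots> \<le> (\<Sum>i\<le>degree P. v (of_rat (coeff (map_poly of_int r) i)) * v \<alpha> ^ i)"
    using r(1) by (intro V_le) (auto intro: order.trans[OF map_poly_degree_leq])
  also have "\<dots> \<le> (\<Sum>i\<le>degree P. v \<alpha> ^ i)"
  proof (rule sum_mono)
    fix i
    have "v (of_rat (coeff (map_poly of_int r) i)) \<le> 1"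
      using padic_abs_int_le_1[OF assms(1), of "coeff r i"] vp[of "of_int (coeff r i)"]
      by (simp add: coeff_map_poly)
    then show "v (of_rat (coeff (map_poly of_int r) i)) * v \<alpha> ^ i \<le> v \<alpha> ^ i"
      using nonneg[of \<alpha>] by (simp add: mult_left_le_one_le nonneg)
  qed
  finally show "v \<alpha> ^ n \<le> (\<Sum>i\<le>degree P. v \<alpha> ^ i)" .
qed

end

section \<open>Archimedean absolute values and complex roots\<close>

definition rat_approx :: "nat \<Rightarrow> real \<Rightarrow> rat" where
  "rat_approx k x = of_int \<lfloor>x * real (Suc k)\<rfloor> / of_nat (Suc k)"

lemma rat_approx_0 [simp]: "rat_approx k 0 = 0"
  by (simp add: rat_approx_def)

lemma rat_approx_error: "\<bar>of_rat (rat_approx k x) - x\<bar> \<le> 1 / real (Suc k)"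
proof -
  have "(of_rat (rat_approx k x) :: real) = of_int \<lfloor>x * real (Suc k)\<rfloor> / real (Suc k)"
    unfolding rat_approx_def of_rat_divide of_rat_of_int_eq of_rat_of_nat_eq ..
  moreover have "\<bar>of_int \<lfloor>x * real (Suc k)\<rfloor> - x * real (Suc k)\<bar> \<le> 1" by linarith
  then have "\<bar>of_int \<lfloor>x * real (Suc k)\<rfloor> - x * real (Suc k)\<bar> / real (Suc k) \<le> 1 / real (Suc k)"
    by (intro divide_right_mono) auto
  moreover have "of_int \<lfloor>x * real (Suc k)\<rfloor> / real (Suc k) - x = (of_int \<lfloor>x * real (Suc k)\<rfloor> - x * real (Suc k)) / real (Suc k)"
    by (simp add: diff_divide_distrib)
  ultimately show ?thesis by (simp add: abs_divide)
qed

lemma rat_approx_tendsto: "(\<lambda>k. of_rat (rat_approx k x)) \<longlonglongrightarrow> x"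
proof (rule LIM_zero_cancel, rule Lim_null_comparison)
  show "eventually (\<lambda>k. norm (of_rat (rat_approx k x) - x) \<le> 1 / real (Suc k)) sequentially"
    using rat_approx_error by simp
  show "(\<lambda>k. 1 / real (Suc k)) \<longlonglongrightarrow> 0"
    using LIMSEQ_Suc[OF lim_1_over_n] by simp
qed

text \<open>Since \<open>rat_approx k 0 = 0\<close>, no new terms arise and the degree stays bounded
  uniformly in \<open>k\<close>.\<close>

definition poly_approx :: "nat \<Rightarrow> real poly \<Rightarrow> rat poly" where
  "poly_approx k f = map_poly (rat_approx k) f"

lemma coeff_poly_approx [simp]: "coeff (poly_approx k f) i = rat_approx k (coeff f i)"
  by (simp add: poly_approx_def coeff_map_poly)

lemma degree_poly_approx: "degree (poly_approx k f) \<le> degree f"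
  unfolding poly_approx_def by (rule map_poly_degree_leq)

lemma convergent_if_diff_bound:
  fixes a b :: "nat \<Rightarrow> real"
  assumes ab: "\<And>m n. dist (a m) (a n) \<le> b m + b n" and "b \<longlonglongrightarrow> 0"
  shows "convergent a"
proof (rule Cauchy_convergent, rule metric_CauchyI)
  fix r :: real assume "r > 0"
  then have "eventually (\<lambda>k. b k < r / 2) sequentially" using order_tendstoD(2)[OF assms(2), of "r / 2"] by simp
  then obtain M where M: "\<And>k. k \<ge> M \<Longrightarrow> b k < r / 2" by (auto simp: eventually_sequentially)
  show "\<exists>M. \<forall>m\<ge>M. \<forall>n\<ge>M. dist (a m) (a n) < r"
  proof (intro exI[of _ M] allI impI)
    fix m n assume "M \<le> m" "M \<le> n"
    then show "dist (a m) (a n) < r" using M[of m] M[of n] ab[of m n] by linarith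
  qed
qed

locale archimedean_place = number_field_place +
  assumes arch: "v (of_rat q) = \<bar>of_rat q\<bar>"
begin

lemma V_diff_le:
  assumes "degree f \<le> n" "degree g \<le> n"
  shows "\<bar>V f - V g\<bar> \<le> (\<Sum>i\<le>n. \<bar>of_rat (coeff f i) - of_rat (coeff g i)\<bar> * v \<alpha> ^ i)"
proof -
  have "\<bar>V f - V g\<bar> \<le> V (f - g)" using v_diff[of "ev f \<alpha>" "ev g \<alpha>"] by simp
  also have "\<dots> \<le> (\<Sum>i\<le>n. v (of_rat (coeff (f - g) i)) * v \<alpha> ^ i)"
    using assms by (intro V_le degree_diff_le)
  also have "\<dots> = (\<Sum>i\<le>n. \<bar>of_rat (coeff f i) - of_rat (coeff g i)\<bar> * v \<alpha> ^ i)"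
    by (subst arch) (simp add: of_rat_diff)
  finally show ?thesis .
qed

text \<open>Completing coefficientwise, the seminorm \<open>V\<close> on \<open>\<rat>[X]\<close> extends to a multiplicative seminorm
  on \<open>\<real>[X]\<close>.\<close>

definition N :: "real poly \<Rightarrow> real" where
  "N f = lim (\<lambda>k. V (poly_approx k f))"

lemma V_approx_tendsto: "(\<lambda>k. V (poly_approx k f)) \<longlonglongrightarrow> N f"
proof -
  define e where "e = (\<lambda>k. \<Sum>i\<le>degree f. \<bar>of_rat (rat_approx k (coeff f i)) - coeff f i\<bar> * v \<alpha> ^ i)"
  have "convergent (\<lambda>k. V (poly_approx k f))"
  proof (rule convergent_if_diff_bound)
    fix k l
    have "\<bar>V (poly_approx k f) - V (poly_approx l f)\<bar> \<le> (\<Sum>i\<le>degree f.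
      \<bar>of_rat (coeff (poly_approx k f) i) - of_rat (coeff (poly_approx l f) i)\<bar> * v \<alpha> ^ i)"
      by (intro V_diff_le degree_poly_approx)
    also have "\<dots> \<le> (\<Sum>i\<le>degree f. \<bar>of_rat (rat_approx k (coeff f i)) - coeff f i\<bar> * v \<alpha> ^ i
        + \<bar>of_rat (rat_approx l (coeff f i)) - coeff f i\<bar> * v \<alpha> ^ i)"
      using nonneg[of \<alpha>] by (intro sum_mono) (auto simp flip: distrib_right intro!: mult_right_mono)
    finally show "dist (V (poly_approx k f)) (V (poly_approx l f)) \<le> e k + e l"
      by (simp add: e_def sum.distrib dist_real_def)
    have "(\<lambda>k. \<bar>of_rat (rat_approx k c) - c\<bar>) \<longlonglongrightarrow> 0" for c :: real
      using tendsto_rabs[OF LIM_zero[OF rat_approx_tendsto[of c]]] by simp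
    then show "e \<longlonglongrightarrow> 0" unfolding e_def by (auto intro!: tendsto_null_sum tendsto_mult_left_zero)
  qed
  then show ?thesis by (simp add: N_def convergent_LIMSEQ_iff)
qed

text \<open>On polynomials of bounded degree \<open>V\<close> is Lipschitz in the coefficients, so
  \<open>N f\<close> can be computed along any coefficientwise approximation. Products and sums of
  approximations are such approximations, which gives \<open>N_mult\<close> and
  \<open>N_add\<close>.\<close>

lemma N_eqI:
  assumes "\<And>k. degree (G k) \<le> n" "degree f \<le> n"
    and "\<And>i. (\<lambda>k. of_rat (coeff (G k) i)) \<longlonglongrightarrow> coeff f i"
  shows "(\<lambda>k. V (G k)) \<longlonglongrightarrow> N f"
proof (rule Lim_transform[OF V_approx_tendsto])
  show "(\<lambda>k. V (G k) - V (poly_approx k f)) \<longlonglongrightarrow> 0"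
  proof (rule Lim_null_comparison)
    show "eventually (\<lambda>k. norm (V (G k) - V (poly_approx k f)) \<le>
      (\<Sum>i\<le>n. \<bar>of_rat (coeff (G k) i) - of_rat (coeff (poly_approx k f) i)\<bar> * v \<alpha> ^ i)) sequentially"
      unfolding real_norm_def
      by (intro always_eventually allI V_diff_le assms order.trans[OF degree_poly_approx])
    have "(\<lambda>k. \<bar>of_rat (coeff (G k) i) - of_rat (coeff (poly_approx k f) i)\<bar>) \<longlonglongrightarrow> \<bar>coeff f i - coeff f i\<bar>" for i
      by (intro tendsto_intros assms) (simp add: rat_approx_tendsto)
    then show "(\<lambda>k. \<Sum>i\<le>n. \<bar>of_rat (coeff (G k) i) - of_rat (coeff (poly_approx k f) i)\<bar> * v \<alpha> ^ i) \<longlonglongrightarrow> 0"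
      by (auto intro!: tendsto_null_sum tendsto_mult_left_zero)
  qed
qed

lemma N_rat: "N (map_poly of_rat f) = V f"
proof -
  have "(\<lambda>k. V f) \<longlonglongrightarrow> N (map_poly of_rat f)"
    by (rule N_eqI[where n="degree f"]) (auto simp: coeff_map_poly intro: map_poly_degree_leq)
  then show ?thesis by (simp add: LIMSEQ_const_iff)
qed

lemma N_mult: "N (f * g) = N f * N g"
proof -
  have "(\<lambda>k. V (poly_approx k f * poly_approx k g)) \<longlonglongrightarrow> N (f * g)"
  proof (rule N_eqI[where n="degree f + degree g"])
    show "degree (poly_approx k f * poly_approx k g) \<le> degree f + degree g" for k
      by (rule order.trans[OF degree_mult_le]) (intro add_mono degree_poly_approx)
    show "(\<lambda>k. of_rat (coeff (poly_approx k f * poly_approx k g) i)) \<longlonglongrightarrow> coeff (f * g) i" for i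
      by (auto simp: coeff_mult of_rat_sum of_rat_mult intro!: tendsto_intros rat_approx_tendsto)
  qed (rule degree_mult_le)
  moreover have "(\<lambda>k. V (poly_approx k f * poly_approx k g)) \<longlonglongrightarrow> N f * N g"
    by (simp add: mult) (intro tendsto_mult V_approx_tendsto)
  ultimately show ?thesis by (rule LIMSEQ_unique)
qed

lemma N_add: "N (f + g) \<le> N f + N g"
proof -
  have "(\<lambda>k. V (poly_approx k f + poly_approx k g)) \<longlonglongrightarrow> N (f + g)"
  proof (rule N_eqI[where n="max (degree f) (degree g)"])
    show "degree (poly_approx k f + poly_approx k g) \<le> max (degree f) (degree g)" for k
      using degree_poly_approx[of k f] degree_poly_approx[of k g] by (intro degree_add_le) auto
    show "(\<lambda>k. of_rat (coeff (poly_approx k f + poly_approx k g) i)) \<longlonglongrightarrow> coeff (f + g) i" for i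
      by (auto simp: of_rat_add intro!: tendsto_intros rat_approx_tendsto)
  qed (rule degree_add_le_max)
  moreover have "(\<lambda>k. V (poly_approx k f) + V (poly_approx k g)) \<longlonglongrightarrow> N f + N g"
    by (intro tendsto_add V_approx_tendsto)
  ultimately show ?thesis by (rule LIMSEQ_le) (auto intro!: add)
qed

lemma N_const: "N [:c:] = \<bar>c\<bar>"
proof -
  have "(\<lambda>k. V [:rat_approx k c:]) \<longlonglongrightarrow> N [:c:]"
    by (rule N_eqI[where n=0]) (auto simp: coeff_pCons rat_approx_tendsto split: nat.splits)
  moreover have "(\<lambda>k. \<bar>of_rat (rat_approx k c)\<bar>) \<longlonglongrightarrow> \<bar>c\<bar>"
    by (intro tendsto_rabs rat_approx_tendsto)
  then have "(\<lambda>k. V [:rat_approx k c:]) \<longlonglongrightarrow> \<bar>c\<bar>" by (simp add: arch)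
  ultimately show ?thesis by (rule LIMSEQ_unique)
qed

end

abbreviation (input) cpoly :: "real poly \<Rightarrow> complex \<Rightarrow> complex" where
  "cpoly f x \<equiv> poly (map_poly of_real f) x"

lemma cpoly_add: "cpoly (f + g) x = cpoly f x + cpoly g x"
  and cpoly_mult: "cpoly (f * g) x = cpoly f x * cpoly g x"
proof -
  have "map_poly of_real (f + g) = (map_poly of_real f + map_poly of_real g :: complex poly)"
    by (simp add: poly_eq_iff coeff_map_poly)
  then show "cpoly (f + g) x = cpoly f x + cpoly g x" by simp
  have "map_poly of_real (f * g) = (map_poly of_real f * map_poly of_real g :: complex poly)"
    by (simp add: poly_eq_iff coeff_map_poly coeff_mult)
  then show "cpoly (f * g) x = cpoly f x * cpoly g x" by simp
qed

text \<open>The real polynomial (X - \<rho>) (X - cnj \<rho>).\<close>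

definition root_quadratic :: "complex \<Rightarrow> real poly" where
  "root_quadratic \<rho> = [:(cmod \<rho>)\<^sup>2, - 2 * Re \<rho>, 1:]"

lemma cpoly_root_quadratic [simp]: "cpoly (root_quadratic \<rho>) \<rho> = 0"
  by (auto simp: root_quadratic_def map_poly_pCons complex_eq_iff cmod_def power2_eq_square algebra_simps)

lemma root_quadratic_division:
  obtains g s t where "f = root_quadratic \<rho> * g + [:t, s:]"
    "cpoly f \<rho> = of_real t + of_real s * \<rho>"
proof -
  define r where "r = f mod root_quadratic \<rho>"
  have "root_quadratic \<rho> \<noteq> 0" "degree (root_quadratic \<rho>) = 2" by (auto simp: root_quadratic_def)
  then have r: "r = 0 \<or> degree r < 2" using degree_mod_less[of "root_quadratic \<rho>" f] by (auto simp: r_def)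
  have r': "r = [:coeff r 0, coeff r 1:]"
    by (rule poly_eqI) (use r in \<open>auto simp: coeff_pCons split: nat.splits intro!: coeff_eq_0\<close>)
  have f: "f = root_quadratic \<rho> * (f div root_quadratic \<rho>) + [:coeff r 0, coeff r 1:]"
    unfolding r'[symmetric] by (simp add: r_def)
  have "cpoly f \<rho> = cpoly [:coeff r 0, coeff r 1:] \<rho>"
    by (subst f) (simp add: cpoly_add cpoly_mult)
  also have "\<dots> = of_real (coeff r 0) + of_real (coeff r 1) * \<rho>" by (simp add: map_poly_pCons)
  finally show ?thesis using f that by blast
qed

text \<open>For nonreal \<open>\<rho>\<close> the numbers 1 and \<open>\<rho>\<close> form a real
  basis of the complex numbers, so coordinates are bounded by a multiple of the modulus.\<close>

lemma affine_bound:
  assumes "Im \<rho> \<noteq> 0" and x: "x = of_real t + of_real s * \<rho>"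
  shows "\<bar>s\<bar> \<le> cmod x / \<bar>Im \<rho>\<bar>" "\<bar>t\<bar> \<le> cmod x * (1 + cmod \<rho> / \<bar>Im \<rho>\<bar>)"
proof -
  have "Im x = s * Im \<rho>" by (simp add: x)
  then show s: "\<bar>s\<bar> \<le> cmod x / \<bar>Im \<rho>\<bar>"
    using assms(1) abs_Im_le_cmod[of x] by (simp add: pos_le_divide_eq abs_mult)
  have "\<bar>t\<bar> = cmod (x - of_real s * \<rho>)" by (simp add: x)
  also have "\<dots> \<le> cmod x + \<bar>s\<bar> * cmod \<rho>" by (rule order.trans[OF norm_triangle_ineq4]) (simp add: norm_mult)
  also have "\<dots> \<le> cmod x + cmod x / \<bar>Im \<rho>\<bar> * cmod \<rho>" using s by (intro add_left_mono mult_right_mono) auto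
  finally show "\<bar>t\<bar> \<le> cmod x * (1 + cmod \<rho> / \<bar>Im \<rho>\<bar>)" by (simp add: algebra_simps)
qed

context archimedean_place
begin

text \<open>A polynomial without real roots is, up to a constant, a product of quadratics
  \<open>root_quadratic \<rho>\<close>. The seminorm \<open>N\<close> is multiplicative and nonzero
  on nonzero constants, so it vanishes on one of them; the induction splits off one quadratic at a
  time.\<close>

lemma null_quadratic:
  assumes "f \<noteq> 0" "N f = 0" "\<And>\<rho>. cpoly f \<rho> = 0 \<Longrightarrow> Im \<rho> \<noteq> 0"
  shows "\<exists>\<rho>. cpoly f \<rho> = 0 \<and> N (root_quadratic \<rho>) = 0"
  using assms
proof (induction "degree f" arbitrary: f rule: less_induct)
  case less
  have "degree f \<noteq> 0"
  proof
    assume "degree f = 0"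
    then obtain c where "f = [:c:]" by (metis degree_eq_zeroE)
    then show False using less.prems by (simp add: N_const)
  qed
  then have "degree (map_poly of_real f :: complex poly) > 0" by (subst degree_map_poly) auto
  then obtain \<rho> where \<rho>: "cpoly f \<rho> = 0" using Fundamental_Theorem_Algebra.fundamental_theorem_of_algebra[of "map_poly of_real f"]
    by (auto simp: constant_degree)
  then have im: "Im \<rho> \<noteq> 0" using less.prems by blast
  obtain g s t where f: "f = root_quadratic \<rho> * g + [:t, s:]" and st: "cpoly f \<rho> = of_real t + of_real s * \<rho>"
    by (rule root_quadratic_division)
  have "s = 0" "t = 0" using affine_bound[OF im st] \<rho> by auto
  then have f: "f = root_quadratic \<rho> * g" using f by simp
  have g: "g \<noteq> 0" using f less.prems by auto
  have "N (root_quadratic \<rho>) * N g = 0" using less.prems f N_mult by simp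
  then consider "N (root_quadratic \<rho>) = 0" | "N g = 0" by auto
  then show ?case
  proof cases
    case 1
    then show ?thesis using \<rho> by blast
  next
    case 2
    have "root_quadratic \<rho> \<noteq> 0" "degree (root_quadratic \<rho>) = 2" by (auto simp: root_quadratic_def)
    then have "degree g < degree f" using f g by (simp add: degree_mult_eq)
    moreover have "Im \<sigma> \<noteq> 0" if "cpoly g \<sigma> = 0" for \<sigma>
      using that less.prems(3)[of \<sigma>] f by (simp add: cpoly_mult)
    ultimately obtain \<sigma> where "cpoly g \<sigma> = 0" "N (root_quadratic \<sigma>) = 0"
      using less.hyps g 2 by blast
    then show ?thesis using f by (auto simp: cpoly_mult)
  qed
qed

lemma cpoly_of_rat: "cpoly (map_poly of_rat f) x = ev f x"
proof -
  have "complex_of_real (of_rat q) = of_rat q" for q by (cases q) (simp add: of_rat_rat)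
  then show ?thesis by (simp add: map_poly_map_poly o_def)
qed

text \<open>Modulo a quadratic on which \<open>N\<close> vanishes, \<open>f\<close> equals its
  affine remainder, whose coefficients are controlled by the value at \<open>\<rho>\<close>. The
  factor in front does not depend on \<open>f\<close>.\<close>

lemma V_bound:
  assumes "N (root_quadratic \<rho>) = 0" "Im \<rho> \<noteq> 0"
  shows "V f \<le> (1 + cmod \<rho> / \<bar>Im \<rho>\<bar> + v \<alpha> / \<bar>Im \<rho>\<bar>) * cmod (ev f \<rho>)"
proof -
  obtain g s t where f: "map_poly of_rat f = root_quadratic \<rho> * g + [:t, s:]"
    and st: "cpoly (map_poly of_rat f) \<rho> = of_real t + of_real s * \<rho>"
    by (rule root_quadratic_division)
  note bounds = affine_bound[OF assms(2) st, unfolded cpoly_of_rat]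
  have NX: "N [:0, 1:] = v \<alpha>" using N_rat[of "[:0, 1:]"] by (simp add: map_poly_pCons)
  have "N [:0, s:] = \<bar>s\<bar> * v \<alpha>" using N_mult[of "[:s:]" "[:0, 1:]"] by (simp add: N_const NX)
  moreover have "N [:t, s:] \<le> N [:t:] + N [:0, s:]" using N_add[of "[:t:]" "[:0, s:]"] by simp
  moreover have "V f \<le> N (root_quadratic \<rho> * g) + N [:t, s:]"
    using N_add[of "root_quadratic \<rho> * g" "[:t, s:]"] f N_rat[of f] by simp
  ultimately have "V f \<le> \<bar>t\<bar> + \<bar>s\<bar> * v \<alpha>" by (simp add: N_mult assms N_const)
  also have "\<dots> \<le> cmod (ev f \<rho>) * (1 + cmod \<rho> / \<bar>Im \<rho>\<bar>) + cmod (ev f \<rho>) / \<bar>Im \<rho>\<bar> * v \<alpha>"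
    using bounds nonneg[of \<alpha>] by (intro add_mono mult_right_mono) auto
  finally show ?thesis by (simp add: algebra_simps)
qed

text \<open>Applying \<open>V_bound\<close> to the powers of \<open>f\<close> removes the constant,
  as both sides are multiplicative.\<close>

lemma V_le_abs:
  assumes "N (root_quadratic \<rho>) = 0" "Im \<rho> \<noteq> 0"
  shows "V f \<le> cmod (ev f \<rho>)"
proof (cases "ev f \<rho> = 0")
  case True
  then show ?thesis using V_bound[OF assms, of f] by simp
next
  case False
  define C where "C = 1 + cmod \<rho> / \<bar>Im \<rho>\<bar> + v \<alpha> / \<bar>Im \<rho>\<bar>"
  have "V f / cmod (ev f \<rho>) \<le> 1"
  proof (rule powers_bounded_imp_le_1)
    fix n
    have "V f ^ n = V (f ^ n)" by (simp add: v_power)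
    also have "\<dots> \<le> C * cmod (ev f \<rho>) ^ n"
      using V_bound[OF assms, of "f ^ n"] by (simp add: C_def norm_power)
    finally show "(V f / cmod (ev f \<rho>)) ^ n \<le> C" using False by (simp add: power_divide pos_divide_le_eq)
  qed
  then show ?thesis using False by simp
qed

text \<open>The polynomial \<open>PQ\<close> is a null vector of \<open>N\<close>, so some root
  \<open>\<rho>\<close> has a null quadratic and \<open>V\<close> is bounded by the modulus at
  \<open>\<rho>\<close>. The same bound for the inverse of a field element yields equality.\<close>

theorem archimedean_place_root:
  assumes nonreal: "\<And>\<rho>. is_root \<rho> \<Longrightarrow> Im \<rho> \<noteq> 0"
  shows "\<exists>\<rho>. is_root \<rho> \<and> (\<forall>f. V f = cmod (ev f \<rho>))"
proof -
  have "N (map_poly of_rat PQ) = 0" using N_rat[of PQ] root by (simp add: ev_PQ)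
  moreover have "map_poly of_rat PQ \<noteq> (0 :: real poly)" using PQ_nonzero by (simp add: map_poly_eq_0_iff)
  moreover have *: "cpoly (map_poly of_rat PQ) \<rho> = 0 \<longleftrightarrow> is_root \<rho>" for \<rho>
    by (simp only: cpoly_of_rat ev_PQ is_root_def)
  ultimately obtain \<rho> where \<rho>: "is_root \<rho>" "N (root_quadratic \<rho>) = 0"
    using null_quadratic nonreal by metis
  have "V f = cmod (ev f \<rho>)" for f
  proof (rule antisym)
    show le: "V f \<le> cmod (ev f \<rho>)" for f using V_le_abs \<rho> nonreal by blast
    show "cmod (ev f \<rho>) \<le> V f"
    proof (cases "ev f \<alpha> = 0")
      case True
      then have "ev f \<rho> = 0" using ev_eq_0_iff \<rho>(1) is_root_generator by blast
      then show ?thesis using nonneg[of "ev f \<alpha>"] by simp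
    next
      case False
      obtain g where g: "inverse (ev f \<alpha>) = ev g \<alpha>" using K_inverse K_cases ev_in_K by metis
      then have 1: "ev (f * g) \<alpha> = ev 1 \<alpha>" using False by (simp flip: g)
      then have "ev (f * g) \<rho> = ev 1 \<rho>" using ev_eq_iff \<rho>(1) is_root_generator by blast
      then have "cmod (ev f \<rho>) * cmod (ev g \<rho>) = 1" by (simp flip: norm_mult)
      moreover have "V f * V g = 1" using 1 by (simp flip: mult)
      moreover have "V f * V g \<le> V f * cmod (ev g \<rho>)" using le[of g] nonneg by (intro mult_left_mono) auto
      ultimately have "cmod (ev f \<rho>) * cmod (ev g \<rho>) \<le> V f * cmod (ev g \<rho>)" by simp
      moreover have "cmod (ev g \<rho>) > 0" using \<open>cmod (ev f \<rho>) * cmod (ev g \<rho>) = 1\<close> by auto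
      ultimately show ?thesis by simp
    qed
  qed
  then show ?thesis using \<rho>(1) by blast
qed

end

section \<open>Complex embeddings and the places they define\<close>

context number_field_generator
begin

text \<open>For a root \<open>\<rho>\<close> and \<open>x\<close> in \<open>K\<close> the value does
  not depend on the chosen \<open>f\<close>, by \<open>ev_eq_iff\<close>.\<close>

definition emb :: "complex \<Rightarrow> complex \<Rightarrow> complex" where
  "emb \<rho> x = ev (SOME f. x = ev f \<alpha>) \<rho>"

lemma emb_ev: "is_root \<rho> \<Longrightarrow> emb \<rho> (ev f \<alpha>) = ev f \<rho>"
  unfolding emb_def by (metis (mono_tags, lifting) ev_eq_iff is_root_generator someI_ex)

lemma emb_hom:
  assumes "is_root \<rho>"
  shows "x \<in> K \<Longrightarrow> y \<in> K \<Longrightarrow> emb \<rho> (x + y) = emb \<rho> x + emb \<rho> y"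
    and "x \<in> K \<Longrightarrow> y \<in> K \<Longrightarrow> emb \<rho> (x - y) = emb \<rho> x - emb \<rho> y"
    and "x \<in> K \<Longrightarrow> y \<in> K \<Longrightarrow> emb \<rho> (x * y) = emb \<rho> x * emb \<rho> y"
  by (elim K_cases, metis emb_ev[OF assms] ev_simps)+

lemma emb_rat [simp]: "is_root \<rho> \<Longrightarrow> emb \<rho> (of_rat q) = of_rat q"
  and emb_gen [simp]: "is_root \<rho> \<Longrightarrow> emb \<rho> \<alpha> = \<rho>"
  using emb_ev[of \<rho> "[:q:]"] emb_ev[of \<rho> "[:0, 1:]"] by simp_all

lemma emb_eq_0_iff: "is_root \<rho> \<Longrightarrow> x \<in> K \<Longrightarrow> emb \<rho> x = 0 \<longleftrightarrow> x = 0"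
  by (elim K_cases) (simp add: emb_ev ev_eq_0_iff is_root_generator)

definition place_of :: "complex \<Rightarrow> complex \<Rightarrow> real" where
  "place_of \<rho> = restrict (\<lambda>x. cmod (emb \<rho> x)) K"

lemma absolute_value_place_of: "is_root \<rho> \<Longrightarrow> absolute_value K (place_of \<rho>)"
  unfolding absolute_value_def place_of_def
  by (auto simp: emb_eq_0_iff emb_hom norm_mult norm_triangle_ineq)

lemma place_of_rat: "is_root \<rho> \<Longrightarrow> place_of \<rho> (of_rat q) = \<bar>of_rat q\<bar>"
proof -
  assume "is_root \<rho>"
  moreover have "cmod (of_rat q) = \<bar>of_rat q\<bar>"
    by (cases q) (simp add: of_rat_rat norm_divide)
  ultimately show ?thesis by (simp add: place_of_def)
qed

lemma archimedean_places:
  assumes nonreal: "\<And>\<rho>. is_root \<rho> \<Longrightarrow> Im \<rho> \<noteq> 0"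
  shows "{v. absolute_value K v \<and> (\<forall>q. v (of_rat q) = \<bar>of_rat q\<bar>)} = place_of ` {\<rho>. is_root \<rho>}"
proof (intro subset_antisym subsetI)
  fix v assume "v \<in> {v. absolute_value K v \<and> (\<forall>q. v (of_rat q) = \<bar>of_rat q\<bar>)}"
  then have v: "absolute_value K v" "\<And>q. v (of_rat q) = \<bar>of_rat q\<bar>" by auto
  interpret archimedean_place P \<alpha> v by unfold_locales (use v in auto)
  obtain \<rho> where \<rho>: "is_root \<rho>" "\<And>f. V f = cmod (ev f \<rho>)"
    using archimedean_place_root nonreal by blast
  have "v x = place_of \<rho> x" for x
  proof (cases "x \<in> K")
    case True
    then show ?thesis using \<rho> by (elim K_cases) (simp add: place_of_def emb_ev)
  next
    case False
    then show ?thesis using v(1) by (auto simp: absolute_value_def place_of_def extensional_def)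
  qed
  then show "v \<in> place_of ` {\<rho>. is_root \<rho>}" using \<rho>(1) by blast
qed (auto simp: absolute_value_place_of place_of_rat)

lemma is_root_cnj: "is_root (cnj \<rho>) \<longleftrightarrow> is_root \<rho>"
  using ev_cnj[of PQ \<rho>] by (simp add: ev_PQ is_root_def)

text \<open>The place determines the distances of the root from 0 and from 1, and these fix a
  complex number up to conjugation.\<close>

lemma place_of_eq_iff:
  assumes "is_root \<rho>" "is_root \<sigma>"
  shows "place_of \<rho> = place_of \<sigma> \<longleftrightarrow> \<sigma> = \<rho> \<or> \<sigma> = cnj \<rho>"
proof
  assume eq: "place_of \<rho> = place_of \<sigma>"
  have *: "cmod (ev f \<rho>) = cmod (ev f \<sigma>)" for f
    using fun_cong[OF eq, of "ev f \<alpha>"] assms by (simp add: place_of_def emb_ev)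
  have "cmod \<rho> = cmod \<sigma>" "cmod (\<rho> - 1) = cmod (\<sigma> - 1)"
    using *[of "[:0, 1:]"] *[of "[:-1, 1:]"] by simp_all
  then have "(Re \<rho>)\<^sup>2 + (Im \<rho>)\<^sup>2 = (Re \<sigma>)\<^sup>2 + (Im \<sigma>)\<^sup>2" "(Re \<rho> - 1)\<^sup>2 + (Im \<rho>)\<^sup>2 = (Re \<sigma> - 1)\<^sup>2 + (Im \<sigma>)\<^sup>2"
    by (simp_all add: cmod_def)
  then have "Re \<rho> = Re \<sigma>" "(Im \<rho>)\<^sup>2 = (Im \<sigma>)\<^sup>2" by (simp_all add: power2_eq_square algebra_simps)
  then show "\<sigma> = \<rho> \<or> \<sigma> = cnj \<rho>" by (auto simp: complex_eq_iff power2_eq_iff)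
next
  assume "\<sigma> = \<rho> \<or> \<sigma> = cnj \<rho>"
  moreover have "place_of (cnj \<rho>) = place_of \<rho>"
    using assms(1) by (intro ext) (auto simp: place_of_def emb_ev is_root_cnj ev_cnj elim!: K_cases)
  ultimately show "place_of \<rho> = place_of \<sigma>" by auto
qed

end

section \<open>The local degree at a complex place\<close>

lemma subfield_Reals: "subfield \<real> complex_field"
  by (rule subfield_complexI) auto

lemma dimension_complex_over_real: "complex_field.dimension 2 \<real> UNIV"
proof -
  have "complex_field.dimension 1 \<real> \<real>"
    by (rule complex_field.dimension_one[OF subfield_Reals])
  then have "complex_field.dimension (Suc 1) \<real> (complex_field.line_extension \<real> \<i> \<real>)"
    by (intro complex_field.Suc_dim) (auto simp: complex_is_Real_iff)
  moreover have "z \<in> complex_field.line_extension \<real> \<i> \<real>" for z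
    unfolding complex_field.line_extension_mem_iff
    by (intro bexI[of _ "of_real (Im z)"] bexI[of _ "of_real (Re z)"]) (auto simp: complex_eq_iff)
  moreover from this have "complex_field.line_extension \<real> \<i> \<real> = UNIV" by auto
  ultimately show ?thesis by (simp add: numeral_2_eq_2)
qed

locale complex_place = number_field_generator +
  fixes \<rho>
  assumes root_\<rho>: "is_root \<rho>" and nonreal: "Im \<rho> \<noteq> 0"
begin

abbreviation "v \<equiv> place_of \<rho>"
abbreviation "R \<equiv> cauchy_ring K v"

lemma v_eq: "x \<in> K \<Longrightarrow> v x = cmod (emb \<rho> x)"
  by (simp add: place_of_def)

lemma cauchy_seqs_iff:
  assumes "S \<subseteq> K"
  shows "s \<in> cauchy_seqs S v \<longleftrightarrow> range s \<subseteq> S \<and> convergent (\<lambda>n. emb \<rho> (s n))"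
proof (cases "range s \<subseteq> S")
  case True
  then have "s n \<in> K" for n using assms by auto
  then have "v (s m - s n) = dist (emb \<rho> (s m)) (emb \<rho> (s n))" for m n
    by (simp add: v_eq emb_hom[OF root_\<rho>] dist_norm)
  then show ?thesis using True
    by (simp add: cauchy_seqs_def Cauchy_convergent_iff[symmetric] Cauchy_def)
qed (auto simp: cauchy_seqs_def)

lemma in_carrier_iff: "s \<in> carrier R \<longleftrightarrow> range s \<subseteq> K \<and> convergent (\<lambda>n. emb \<rho> (s n))"
  using cauchy_seqs_iff[of K] by (simp add: cauchy_ring_def)

lemma cauchy_ring_simps:
  "s \<otimes>\<^bsub>R\<^esub> t = (\<lambda>n. s n * t n)" "s \<oplus>\<^bsub>R\<^esub> t = (\<lambda>n. s n + t n)"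
  "\<one>\<^bsub>R\<^esub> = (\<lambda>_. 1)" "\<zero>\<^bsub>R\<^esub> = (\<lambda>_. 0)"
  by (simp_all add: cauchy_ring_def)

lemma cauchy_ring_is_ring: "ring R"
proof (rule ringI)
  show "abelian_group R"
  proof (rule abelian_groupI)
    fix s assume s: "s \<in> carrier R"
    have *: "emb \<rho> (- s n) = - emb \<rho> (s n)" for n
      using s emb_hom(2)[OF root_\<rho>, of 0 "s n"] emb_rat[OF root_\<rho>, of 0] by (auto simp: in_carrier_iff)
    show "\<exists>t\<in>carrier R. t \<oplus>\<^bsub>R\<^esub> s = \<zero>\<^bsub>R\<^esub>"
      using s by (intro bexI[of _ "\<lambda>n. - s n"])
         (auto simp: in_carrier_iff cauchy_ring_simps * intro: convergent_minus_iff[THEN iffD1])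
  qed (auto simp: in_carrier_iff cauchy_ring_simps emb_hom[OF root_\<rho>] image_subset_iff algebra_simps
        intro: convergent_add convergent_const)
  show "monoid R"
    using emb_rat[OF root_\<rho>, of 1]
    by (intro monoidI) (auto simp: in_carrier_iff cauchy_ring_simps emb_hom[OF root_\<rho>] image_subset_iff
        algebra_simps intro: convergent_mult convergent_const)
qed (auto simp: cauchy_ring_simps algebra_simps)

text \<open>This limit map will be a surjective ring homomorphism with kernel
  \<open>null_seqs K v\<close>, so it identifies the completion with the complex numbers.\<close>

definition L :: "(nat \<Rightarrow> complex) \<Rightarrow> complex" where
  "L s = lim (\<lambda>n. emb \<rho> (s n))"

lemma L_tendsto: "s \<in> carrier R \<Longrightarrow> (\<lambda>n. emb \<rho> (s n)) \<longlonglongrightarrow> L s"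
  by (simp add: in_carrier_iff L_def convergent_LIMSEQ_iff)

lemma L_eqI: "s \<in> carrier R \<Longrightarrow> (\<lambda>n. emb \<rho> (s n)) \<longlonglongrightarrow> z \<Longrightarrow> L s = z"
  using L_tendsto LIMSEQ_unique by blast

lemma L_hom: "ring_hom_ring R complex_field L"
proof (rule ring_hom_ringI)
  show "ring R" by (rule cauchy_ring_is_ring)
  show "ring complex_field" by (rule ring_from_type_algebra)
  interpret R: ring R by (rule cauchy_ring_is_ring)
  fix s t assume st: "s \<in> carrier R" "t \<in> carrier R"
  then have K: "s n \<in> K" "t n \<in> K" for n by (auto simp: in_carrier_iff)
  show "L (s \<otimes>\<^bsub>R\<^esub> t) = L s \<otimes>\<^bsub>complex_field\<^esub> L t"
    using st K tendsto_mult[OF L_tendsto[OF st(1)] L_tendsto[OF st(2)]] R.m_closed[OF st]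
    by (intro L_eqI) (simp_all add: cauchy_ring_simps emb_hom[OF root_\<rho>])
  show "L (s \<oplus>\<^bsub>R\<^esub> t) = L s \<oplus>\<^bsub>complex_field\<^esub> L t"
    using st K tendsto_add[OF L_tendsto[OF st(1)] L_tendsto[OF st(2)]] R.a_closed[OF st]
    by (intro L_eqI) (simp_all add: cauchy_ring_simps emb_hom[OF root_\<rho>])
next
  interpret R: ring R by (rule cauchy_ring_is_ring)
  show "L \<one>\<^bsub>R\<^esub> = \<one>\<^bsub>complex_field\<^esub>"
    using R.one_closed emb_rat[OF root_\<rho>, of 1] by (intro L_eqI) (simp_all add: cauchy_ring_simps)
qed simp

lemma kernel_L: "a_kernel R complex_field L = null_seqs K v"
proof -
  have "L s = 0 \<longleftrightarrow> (\<lambda>n. v (s n)) \<longlonglongrightarrow> 0" if s: "s \<in> carrier R" for s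
  proof -
    have "s n \<in> K" for n using s by (auto simp: in_carrier_iff)
    then have "(\<lambda>n. v (s n)) = (\<lambda>n. norm (emb \<rho> (s n)))" by (simp add: v_eq)
    then have "(\<lambda>n. v (s n)) \<longlonglongrightarrow> 0 \<longleftrightarrow> (\<lambda>n. emb \<rho> (s n)) \<longlonglongrightarrow> 0"
      by (simp add: tendsto_norm_zero_iff)
    then show ?thesis using L_eqI[OF s, of 0] L_tendsto[OF s] by metis
  qed
  moreover have "carrier R = cauchy_seqs K v" by (simp add: cauchy_ring_def)
  ultimately show ?thesis by (auto simp: a_kernel_def' null_seqs_def)
qed

lemma Rats_subset_K: "\<rat> \<subseteq> K" by (auto elim: Rats_cases)

lemma rat_approx_complex: "(\<lambda>n. complex_of_real (of_rat (rat_approx n x))) \<longlonglongrightarrow> of_real x"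
  by (intro tendsto_of_real rat_approx_tendsto)

lemma of_real_of_rat: "complex_of_real (of_rat q) = of_rat q"
  by (cases q) (simp add: of_rat_rat)

text \<open>In the real basis 1, \<open>\<rho>\<close> of the complex numbers, \<open>z\<close> has
  coordinates \<open>x\<close> and \<open>y\<close>. Rational approximations of these, with
  \<open>\<alpha>\<close> in place of \<open>\<rho>\<close>, form a sequence in \<open>K\<close>
  whose images converge to \<open>z\<close>.\<close>

lemma L_surj: "L ` carrier R = UNIV"
proof -
  have "z \<in> L ` carrier R" for z
  proof -
    define y where "y = Im z / Im \<rho>"
    define x where "x = Re z - y * Re \<rho>"
    define s where "s = (\<lambda>n. of_rat (rat_approx n x) + of_rat (rat_approx n y) * \<alpha>)"
    have "of_real x + of_real y * \<rho> = z" using nonreal by (simp add: complex_eq_iff x_def y_def)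
    then have "(\<lambda>n. complex_of_real (of_rat (rat_approx n x)) + complex_of_real (of_rat (rat_approx n y)) * \<rho>) \<longlonglongrightarrow> z"
      using tendsto_add[OF rat_approx_complex tendsto_mult[OF rat_approx_complex tendsto_const], of x y \<rho>] by simp
    then have lim: "(\<lambda>n. emb \<rho> (s n)) \<longlonglongrightarrow> z"
      by (simp add: s_def emb_hom[OF root_\<rho>] root_\<rho> of_real_of_rat)
    then have "s \<in> carrier R" by (auto simp: in_carrier_iff s_def intro: convergentI)
    then show ?thesis using L_eqI lim by blast
  qed
  then show ?thesis by auto
qed

lemma L_rational: "L ` cauchy_seqs \<rat> v = \<real>"
proof (intro subset_antisym subsetI)
  fix z assume "z \<in> L ` cauchy_seqs \<rat> v"
  then obtain s where s: "s \<in> cauchy_seqs \<rat> v" "z = L s" by auto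
  then have "range s \<subseteq> \<rat>" and car: "s \<in> carrier R"
    using cauchy_seqs_iff[OF Rats_subset_K, of s] Rats_subset_K by (auto simp: in_carrier_iff)
  then have "emb \<rho> (s n) \<in> \<real>" for n
  proof -
    obtain q where "s n = of_rat q" using \<open>range s \<subseteq> \<rat>\<close> Rats_cases by blast
    then have "emb \<rho> (s n) = of_real (of_rat q)" by (simp only: of_real_of_rat emb_rat[OF root_\<rho>])
    then show ?thesis by (simp only: Reals_of_real)
  qed
  then show "z \<in> \<real>" unfolding s(2)
    using L_tendsto[OF car] by (rule closed_sequentially[OF closed_complex_Reals])
next
  fix z :: complex assume "z \<in> \<real>"
  then obtain x where z: "z = of_real x" by (auto elim: Reals_cases)
  define s where "s = (\<lambda>n. of_rat (rat_approx n x) :: complex)"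
  have lim: "(\<lambda>n. emb \<rho> (s n)) \<longlonglongrightarrow> z"
    using rat_approx_complex[of x] root_\<rho> by (simp add: s_def z of_real_of_rat)
  then have "s \<in> cauchy_seqs \<rat> v"
    by (auto simp: cauchy_seqs_iff[OF Rats_subset_K] s_def intro: convergentI)
  moreover have "s \<in> carrier R" using lim by (auto simp: in_carrier_iff s_def intro: convergentI)
  ultimately show "z \<in> L ` cauchy_seqs \<rat> v" using L_eqI lim by blast
qed

text \<open>By the first isomorphism theorem \<open>L\<close> induces an isomorphism of the
  completion with the complex numbers that takes the rational completion to the reals. The dimension
  2 is carried back along its inverse \<open>\<Psi>\<close>.\<close>

theorem local_degree_eq_2: "local_degree K v = 2"
proof -
  interpret L: ring_hom_ring R complex_field L by (rule L_hom)
  define \<Phi> where "\<Phi> = (\<lambda>A. the_elem (L ` A))"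
  define C where "C = completion K v"
  have C: "C = R Quot a_kernel R complex_field L" by (simp add: C_def completion_def kernel_L)
  have ringC: "ring C" unfolding C by (intro ideal.quotient_is_ring L.kernel_is_ideal)
  have iso: "\<Phi> \<in> ring_iso C complex_field"
    unfolding C \<Phi>_def by (rule L.FactRing_iso_set) (simp add: L_surj)
  define \<Psi> where "\<Psi> = inv_into (carrier C) \<Phi>"
  have iso': "\<Psi> \<in> ring_iso complex_field C"
    unfolding \<Psi>_def by (rule ring_iso_set_sym[OF ringC iso])
  have bij: "bij_betw \<Phi> (carrier C) UNIV" using iso by (simp add: ring_iso_def)
  interpret \<Psi>: ring_hom_ring complex_field C \<Psi>
    using iso' ringC by (intro ring_hom_ringI2) (auto simp: ring_iso_def intro: ring_from_type_algebra)
  have inj: "inj \<Psi>" and surj: "range \<Psi> = carrier C"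
    using iso' by (auto simp: ring_iso_def bij_betw_def)
  have nontriv: "\<one>\<^bsub>C\<^esub> \<noteq> \<zero>\<^bsub>C\<^esub>"
  proof
    assume "\<one>\<^bsub>C\<^esub> = \<zero>\<^bsub>C\<^esub>"
    then have "\<Psi> 1 = \<Psi> 0" using \<Psi>.hom_one \<Psi>.hom_zero by simp
    then show False using inj by (simp add: inj_eq)
  qed
  have coset: "null_seqs K v +>\<^bsub>R\<^esub> s \<in> carrier C" "\<Phi> (null_seqs K v +>\<^bsub>R\<^esub> s) = L s" if "s \<in> carrier R" for s
    unfolding C kernel_L[symmetric] \<Phi>_def FactRing_def A_RCOSETS_def' using that L.the_elem_simp[OF that] by auto
  have "\<Psi> ` \<real> = rat_completion K v"
  proof -
    have sub: "cauchy_seqs \<rat> v \<subseteq> carrier R"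
    proof
      fix s assume "s \<in> cauchy_seqs \<rat> v"
      then have "range s \<subseteq> \<rat>" "convergent (\<lambda>n. emb \<rho> (s n))"
        by (simp_all only: cauchy_seqs_iff[OF Rats_subset_K])
      then show "s \<in> carrier R" unfolding in_carrier_iff using Rats_subset_K by blast
    qed
    have "\<Psi> (L s) = null_seqs K v +>\<^bsub>R\<^esub> s" if "s \<in> carrier R" for s
      unfolding \<Psi>_def using coset[OF that] bij by (metis bij_betw_inv_into_left)
    then show ?thesis unfolding rat_completion_def L_rational[symmetric] image_image
      using sub by (intro image_cong) auto
  qed
  moreover have "\<Psi>.S.dimension 2 (\<Psi> ` \<real>) (\<Psi> ` UNIV)"
    using \<Psi>.inj_hom_dimension[OF subfield_Reals nontriv] inj dimension_complex_over_real by blast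
  moreover have "subfield (\<Psi> ` \<real>) C" by (rule \<Psi>.img_is_subfield(2)[OF subfield_Reals nontriv])
  ultimately have "ring.dim C (rat_completion K v) (carrier C) = 2"
    using ring.dimI[OF ringC] by (simp add: surj over_def)
  then show ?thesis by (simp add: local_degree_def C_def)
qed

end

section \<open>The height as a Mahler measure\<close>

lemma log_plus_le_1: "0 \<le> x \<Longrightarrow> x \<le> 1 \<Longrightarrow> log_plus x = 0"
  by (auto simp: log_plus_def)

lemma log_plus_ge_1: "1 \<le> x \<Longrightarrow> log_plus x = ln x"
  by (auto simp: log_plus_def)

lemma log_plus_power: "0 \<le> x \<Longrightarrow> log_plus (x ^ k) = real k * log_plus x"
proof (cases "x \<le> 1")
  case True
  assume "0 \<le> x"
  then show ?thesis using True by (simp add: log_plus_le_1 power_le_one)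
next
  case False
  then show ?thesis by (simp add: log_plus_ge_1 one_le_power ln_realpow)
qed

context number_field_generator
begin

text \<open>A complex place belongs to exactly two roots, \<open>\<rho>\<close> and
  \<open>cnj \<rho>\<close>, of equal modulus. Its local degree 2 therefore counts each root
  once.\<close>

theorem weil_height_eq:
  assumes nonreal: "\<And>\<rho>. is_root \<rho> \<Longrightarrow> Im \<rho> \<noteq> 0"
  shows "weil_height \<alpha> = (\<Sum>\<rho> | is_root \<rho>. log_plus (cmod \<rho>)) / degree P"
proof -
  define S where "S = {\<rho>. is_root \<rho>}"
  define loc where "loc = (\<lambda>v. log_plus (v \<alpha> ^ local_degree K v))"
  have fin: "finite S" unfolding S_def by (rule finite_roots)
  have loc_place: "loc (place_of \<rho>) = 2 * log_plus (cmod \<rho>)" if "is_root \<rho>" for \<rho>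
  proof -
    interpret complex_place P \<alpha> \<rho> by unfold_locales (use that nonreal in auto)
    show ?thesis using that by (simp only: loc_def local_degree_eq_2) (simp add: log_plus_power place_of_def)
  qed
  have arch: "{v. absolute_value K v \<and> (\<forall>q. v (of_rat q) = \<bar>of_rat q\<bar>)} = place_of ` S"
    unfolding S_def using archimedean_places nonreal by blast
  have "infsum loc (places K) = infsum loc (place_of ` S)"
  proof (rule infsum_cong_neutral)
    fix v assume v: "v \<in> places K - place_of ` S"
    then have av: "absolute_value K v" by (simp add: places_def)
    then interpret number_field_place P \<alpha> v by unfold_locales
    obtain p where "Factorial_Ring.prime p" "\<And>q. v (of_rat q) = padic_abs p q"
      using v av unfolding places_def arch[symmetric] by blast
    then have "v \<alpha> \<le> 1" by (rule nonarchimedean_le_1)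
    then show "loc v = 0" using nonneg[of \<alpha>] by (simp add: loc_def log_plus_le_1 power_le_one)
  qed (use arch in \<open>auto simp: places_def\<close>)
  also have "\<dots> = sum loc (place_of ` S)" using fin by simp
  also have "\<dots> = (\<Sum>w\<in>place_of ` S. \<Sum>\<rho>\<in>{x \<in> S. place_of x = w}. log_plus (cmod \<rho>))"
  proof (rule sum.cong)
    fix w assume "w \<in> place_of ` S"
    then obtain \<rho> where \<rho>: "is_root \<rho>" "w = place_of \<rho>" by (auto simp: S_def)
    have "{x \<in> S. place_of x = w} = {\<rho>, cnj \<rho>}"
      using place_of_eq_iff \<rho> by (auto simp: S_def is_root_cnj)
    moreover have "\<rho> \<noteq> cnj \<rho>" using nonreal[OF \<rho>(1)] by (auto simp: complex_eq_iff)
    ultimately show "loc w = (\<Sum>\<rho>\<in>{x \<in> S. place_of x = w}. log_plus (cmod \<rho>))"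
      using loc_place[OF \<rho>(1)] \<rho>(2) by simp
  qed simp
  also have "\<dots> = (\<Sum>\<rho>\<in>S. log_plus (cmod \<rho>))" by (rule sum.image_gen[OF fin, symmetric])
  finally show ?thesis
    by (simp add: weil_height_def generate_field_eq height_over_def dim_K S_def loc_def)
qed

lemma weil_height_eq_proots:
  assumes nonreal: "\<And>\<rho>. is_root \<rho> \<Longrightarrow> Im \<rho> \<noteq> 0"
  shows "weil_height \<alpha> = (\<Sum>\<rho>\<in>#proots (map_poly of_int P). log_plus (cmod \<rho>)) / degree P"
proof -
  have "weil_height \<alpha> = (\<Sum>\<rho> | is_root \<rho>. log_plus (cmod \<rho>)) / degree P"
    using nonreal by (rule weil_height_eq)
  then show ?thesis by (simp only: proots_eq sum_unfold_sum_mset)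
qed

end

text \<open>For monic \<open>p\<close> this is the logarithm of the Mahler measure; a leading
  coefficient would contribute a term of its own.\<close>

definition log_mahler :: "complex poly \<Rightarrow> real" where
  "log_mahler p = (\<Sum>\<rho>\<in>#proots p. log_plus (cmod \<rho>))"

lemma poly_quartic: "poly quartic z = (z - z\<^sup>2)\<^sup>2 - (z - z\<^sup>2) + (1 :: 'a :: comm_ring_1)"
  by (simp add: quartic_def algebra_simps power2_eq_square power4_eq_xxxx)

lemma poly_quartic_reflect: "poly quartic (1 - z) = (poly quartic z :: 'a :: comm_ring_1)"
  by (simp add: poly_quartic algebra_simps power2_eq_square)

lemma of_int_quartic_power:
  "map_poly of_int ((quartic :: int poly) ^ n + [:c:]) = (quartic ^ n + [:of_int c:] :: 'a :: {comm_ring_1,ring_char_0} poly)"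
proof -
  have add: "map_poly of_int (f + g) = (map_poly of_int f + map_poly of_int g :: 'a poly)" for f g
    by (simp add: poly_eq_iff coeff_map_poly)
  have mult: "map_poly of_int (f * g) = (map_poly of_int f * map_poly of_int g :: 'a poly)" for f g
    by (simp add: poly_eq_iff coeff_map_poly coeff_mult)
  have "map_poly of_int (quartic ^ n) = (quartic ^ n :: 'a poly)"
    by (induction n) (simp_all add: mult, simp add: quartic_def map_poly_pCons)
  then show ?thesis by (simp add: add map_poly_pCons)
qed

text \<open>The degree is \<open>4 * n\<close>, and the two equal summands of the Zhang-Zagier
  height turn this divisor into \<open>2 * n\<close>.\<close>

definition quartic_height :: "nat \<Rightarrow> nat \<Rightarrow> real" where
  "quartic_height n c = log_mahler (quartic ^ n + [:of_nat c:]) / (2 * n)"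

lemma quartic_height_attained:
  assumes "even n" "n > 0" "c mod 4 = 2" "poly quartic \<alpha> ^ n = - of_nat c"
  shows "algebraic \<alpha>" "zhang_zagier_height \<alpha> = quartic_height n c"
proof -
  define k where "k = int c div 2"
  have k: "odd k" "int c = 2 * k" unfolding k_def using assms(3) by presburger+
  define P where "P = (quartic :: int poly) ^ n + [:2 * k:]"
  have PC: "map_poly of_int P = (quartic ^ n + [:of_nat c:] :: complex poly)"
    unfolding P_def of_int_quartic_power k(2)[symmetric] by simp
  have gen: "number_field_generator P \<beta>" if "poly quartic \<beta> ^ n = - of_nat c" for \<beta>
    using irreducible_quartic_power[OF k(1) assms(2)] monic_quartic_power(2)[OF assms(2)] that
    by unfold_locales (simp_all add: PC, simp_all add: P_def)
  have height: "weil_height \<beta> = log_mahler (quartic ^ n + [:of_nat c:]) / (4 * n)"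
    if \<beta>: "poly quartic \<beta> ^ n = - of_nat c" for \<beta>
  proof -
    interpret number_field_generator P \<beta> by (rule gen[OF \<beta>])
    have "Im \<rho> \<noteq> 0" if "is_root \<rho>" for \<rho>
    proof
      assume "Im \<rho> = 0"
      then obtain x where x: "\<rho> = of_real x" by (metis complex_is_Real_iff Reals_cases)
      have "poly quartic \<rho> ^ n + of_nat c = 0" using that by (simp add: is_root_def PC)
      then have "complex_of_real (poly quartic x ^ n + of_nat c) = 0" by (simp add: x poly_quartic)
      then have "poly quartic x ^ n + real c = 0" by (simp only: of_real_eq_0_iff)
      moreover have "poly quartic x ^ n \<ge> 0" using assms(1) by (simp add: zero_le_even_power)
      moreover have "c > 0" using assms(3) by (cases c) auto
      ultimately show False by simp
    qed
    then show ?thesis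
      using weil_height_eq_proots monic_quartic_power(1)[OF assms(2), of "2 * k"]
      by (simp add: PC log_mahler_def) (simp add: P_def)
  qed
  have "poly quartic (1 - \<alpha>) ^ n = - of_nat c" using assms(4) by (simp add: poly_quartic_reflect)
  then show "zhang_zagier_height \<alpha> = quartic_height n c"
    using height assms(4) by (simp add: zhang_zagier_height_def quartic_height_def)
  interpret number_field_generator P \<alpha> by (rule gen[OF assms(4)])
  show "algebraic \<alpha>"
    by (rule algebraicI[of "map_poly of_int P"]) (use root irr in \<open>auto simp: coeff_map_poly map_poly_eq_0_iff\<close>)
qed

lemma exists_quartic_root:
  assumes "n > 0"
  shows "\<exists>\<alpha>. poly quartic \<alpha> ^ n = (- of_nat c :: complex)"
proof -
  have "degree ((quartic :: complex poly) ^ n + [:of_nat c:]) = 4 * n"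
    using assms by (subst degree_add_eq_left) (auto simp: degree_power_eq quartic_def)
  then have "\<exists>\<alpha>. poly (quartic ^ n + [:of_nat c:]) \<alpha> = (0 :: complex)"
    using Fundamental_Theorem_Algebra.fundamental_theorem_of_algebra[of "quartic ^ n + [:of_nat c:]"] assms
    by (auto simp: constant_degree)
  then show ?thesis by (auto simp: eq_neg_iff_add_eq_0)
qed

section \<open>Variation of the constant term\<close>

text \<open>The principal square root jumps by a sign across the negative real axis, which an even
  function does not see. Near the cut the other branch \<open>\<i> * csqrt (- z)\<close> is
  continuous and agrees with \<open>csqrt z\<close> up to sign.\<close>

lemma continuous_of_even_square_root:
  fixes h :: "complex \<Rightarrow> real"
  assumes h: "continuous_on UNIV h" and even: "\<And>y. h (- y) = h y"
  shows "continuous_on UNIV (\<lambda>u. h (csqrt u))"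
proof -
  have isCont_h: "isCont h y" for y
    using h by (simp add: continuous_on_eq_continuous_at)
  have "isCont (\<lambda>u. h (csqrt u)) u" for u
  proof (cases "u \<in> \<real>\<^sub>\<le>\<^sub>0")
    case False
    then have "isCont csqrt u" by (rule continuous_at_csqrt)
    then show ?thesis using isCont_h by (rule isCont_o2)
  next
    case True
    show ?thesis
    proof (cases "u = 0")
      case True
      have "((\<lambda>u::complex. sqrt (norm u)) \<longlongrightarrow> sqrt (norm (0::complex))) (at 0)" by (intro tendsto_intros)
      then have "((\<lambda>u. norm (csqrt u)) \<longlongrightarrow> 0) (at 0)"
        by (simp only: norm_csqrt norm_zero real_sqrt_zero)
      then have "(csqrt \<longlongrightarrow> 0) (at 0)" by (rule tendsto_norm_zero_cancel)
      then have "isCont csqrt 0" by (simp add: isCont_def)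
      then show ?thesis unfolding True using isCont_h by (rule isCont_o2)
    next
      case False
      have "h (csqrt z) = h (\<i> * csqrt (- z))" for z
      proof -
        have "(csqrt z)\<^sup>2 = (\<i> * csqrt (- z))\<^sup>2" by (simp add: power_mult_distrib)
        then have "csqrt z = \<i> * csqrt (- z) \<or> csqrt z = - (\<i> * csqrt (- z))" by (simp only: power2_eq_iff)
        then show ?thesis using even by metis
      qed
      moreover have "- u \<notin> \<real>\<^sub>\<le>\<^sub>0" using \<open>u \<in> \<real>\<^sub>\<le>\<^sub>0\<close> False
        by (auto simp: complex_nonpos_Reals_iff complex_eq_iff)
      then have "isCont (\<lambda>z. \<i> * csqrt (- z)) u"
        by (intro continuous_intros isCont_o2[OF _ continuous_at_csqrt]) auto
      then have "isCont (\<lambda>z. h (\<i> * csqrt (- z))) u" using isCont_h by (rule isCont_o2)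
      ultimately show ?thesis by simp
    qed
  qed
  then show ?thesis by (simp add: continuous_on_eq_continuous_at)
qed

text \<open>The points are the two roots of X^2 - X + 1/4 - u.\<close>

definition sum_over_roots :: "(complex \<Rightarrow> real) \<Rightarrow> complex \<Rightarrow> real" where
  "sum_over_roots f u = f (1/2 + csqrt u) + f (1/2 - csqrt u)"

lemma continuous_sum_over_roots:
  assumes "continuous_on UNIV f"
  shows "continuous_on UNIV (sum_over_roots f)"
  unfolding sum_over_roots_def
proof (rule continuous_of_even_square_root)
  show "continuous_on UNIV (\<lambda>y. f (1/2 + y) + f (1/2 - y))"
    by (intro continuous_intros continuous_on_compose2[OF assms]) auto
qed (simp add: add.commute)

lemma continuous_log_plus: "continuous_on UNIV (\<lambda>z::complex. log_plus (cmod z))"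
proof -
  have "log_plus (cmod z) = ln (max 1 (cmod z))" for z :: complex
    by (cases "cmod z \<le> 1") (auto simp: log_plus_le_1 log_plus_ge_1 max_def)
  then show ?thesis by (auto intro!: continuous_intros)
qed

lemma log_mahler_mult: "p * q \<noteq> 0 \<Longrightarrow> log_mahler (p * q) = log_mahler p + log_mahler q"
  by (simp add: log_mahler_def proots_mult)

lemma log_mahler_prod:
  "finite A \<Longrightarrow> (\<And>a. a \<in> A \<Longrightarrow> f a \<noteq> 0) \<Longrightarrow> log_mahler (\<Prod>a\<in>A. f a) = (\<Sum>a\<in>A. log_mahler (f a))"
proof (induction A rule: finite_induct)
  case empty
  then show ?case by (simp add: log_mahler_def)
next
  case (insert a A)
  then show ?case by (simp add: log_mahler_mult prod_zero_iff)
qed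

lemma log_mahler_linear: "log_mahler [:- a, 1:] = log_plus (cmod a)"
  by (simp add: log_mahler_def)

lemma log_mahler_quadratic:
  "log_mahler [:w, -1, 1:] = sum_over_roots (\<lambda>z. log_plus (cmod z)) (1/4 - w)"
proof -
  define y where "y = csqrt (1/4 - w)"
  have "y * y = 1/4 - w" unfolding y_def by (metis power2_csqrt power2_eq_square)
  then have eq: "[:w, -1, 1:] = [:- (1/2 + y), 1:] * [:- (1/2 - y), 1:]"
    by (simp add: algebra_simps)
  have nz: "[:- (1/2 + y), 1:] * [:- (1/2 - y), 1:] \<noteq> 0" by simp
  show ?thesis
    unfolding eq log_mahler_mult[OF nz] log_mahler_linear sum_over_roots_def y_def[symmetric] ..
qed

definition log_mahler_fibre :: "complex \<Rightarrow> real" where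
  "log_mahler_fibre b = log_mahler (quartic - [:b:])"

lemma quartic_minus_const_nonzero: "quartic - [:b:] \<noteq> (0 :: complex poly)"
  by (simp add: quartic_def)

text \<open>As \<open>quartic\<close> is quadratic in X - X^2, the roots of
  \<open>quartic - [:b:]\<close> come from two successive square roots: it is the product of the
  quadratics X^2 - X + w, where w runs through 1/2 plus and minus a square root of b - 3/4. Two
  applications of \<open>sum_over_roots\<close> thus give continuity.\<close>

lemma continuous_log_mahler_fibre: "continuous_on UNIV log_mahler_fibre"
proof -
  define g where "g = (\<lambda>w. log_mahler [:w, -1, 1:])"
  have "continuous_on UNIV g"
    unfolding g_def log_mahler_quadratic
    by (intro continuous_intros continuous_on_compose2[OF continuous_sum_over_roots[OF continuous_log_plus]]) auto
  then have cont: "continuous_on UNIV (\<lambda>b. sum_over_roots g (b - 3/4))"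
    by (rule continuous_on_compose2[OF continuous_sum_over_roots]) (auto intro: continuous_intros)
  have "log_mahler_fibre b = sum_over_roots g (b - 3/4)" for b
  proof -
    define y where "y = csqrt (b - 3/4)"
    have y: "y * y = b - 3/4" unfolding y_def by (metis power2_csqrt power2_eq_square)
    have "[:1/2 + y, -1, 1:] * [:1/2 - y, -1, 1:] = [:1/4 - y * y, -1, 2, -2, 1:]"
      by (simp add: algebra_simps)
    also have "\<dots> = quartic - [:b:]" unfolding y by (simp add: quartic_def)
    finally have "quartic - [:b:] = [:1/2 + y, -1, 1:] * [:1/2 - y, -1, 1:]" ..
    moreover have nz: "[:1/2 + y, -1, 1:] * [:1/2 - y, -1, 1:] \<noteq> 0" by simp
    ultimately have "log_mahler (quartic - [:b:]) = g (1/2 + y) + g (1/2 - y)"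
      by (simp only: log_mahler_mult[OF nz] g_def)
    then show ?thesis by (simp add: log_mahler_fibre_def sum_over_roots_def y_def)
  qed
  then have eq: "log_mahler_fibre = (\<lambda>b. sum_over_roots g (b - 3/4))" by (rule ext)
  show ?thesis by (subst eq) (rule cont)
qed

definition radicals :: "nat \<Rightarrow> nat \<Rightarrow> complex set" where
  "radicals n c = {b. b ^ n = - of_nat c}"

lemma card_radicals: "n > 0 \<Longrightarrow> c > 0 \<Longrightarrow> card (radicals n c) = n"
  unfolding radicals_def by (rule card_nth_roots) auto

lemma finite_radicals: "n > 0 \<Longrightarrow> c > 0 \<Longrightarrow> finite (radicals n c)"
  using card_radicals[of n c] by (metis card.infinite less_irrefl)

lemma norm_radical:
  assumes "n > 0" "b \<in> radicals n c"
  shows "cmod b = root n c"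
proof -
  have "cmod b ^ n = real c" using assms(2) by (simp add: radicals_def flip: norm_power)
  then show ?thesis using assms(1) by (metis norm_ge_zero real_root_power_cancel)
qed

text \<open>The polynomial X^n + c has simple roots; its linear factorization is evaluated at
  \<open>quartic\<close>.\<close>

lemma quartic_power_factorization:
  assumes "n > 0" "c > 0"
  shows "quartic ^ n + [:of_nat c:] = (\<Prod>b\<in>radicals n c. quartic - [:b:])"
proof -
  define p :: "complex poly" where "p = Polynomial.monom 1 n + [:of_nat c:]"
  have p: "poly p x = x ^ n + of_nat c" for x by (simp add: p_def poly_monom)
  have roots: "{x. poly p x = 0} = radicals n c" by (auto simp: p radicals_def eq_neg_iff_add_eq_0)
  have deg: "degree p = n" using assms(1) unfolding p_def
    by (subst degree_add_eq_left) (auto simp: degree_monom_eq)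
  have lc: "lead_coeff p = 1" unfolding deg using assms(1) by (simp add: p_def coeff_eq_0)
  have "rsquarefree p"
    unfolding rsquarefree_roots
  proof (intro allI notI)
    fix x assume "poly p x = 0 \<and> poly (pderiv p) x = 0"
    moreover have "poly (pderiv p) x = of_nat n * x ^ (n - 1)"
      by (simp add: p_def pderiv_add pderiv_monom poly_monom pderiv_pCons)
    ultimately have "x ^ n + of_nat c = 0" "x = 0" using assms(1) by (auto simp: p)
    then show False using assms by (simp add: power_0_left)
  qed
  then have "p = (\<Prod>b\<in>radicals n c. [:- b, 1:])"
    using complex_poly_decompose_rsquarefree[of p] lc roots by simp
  then have *: "poly p x = (\<Prod>b\<in>radicals n c. x - b)" for x by (simp add: poly_prod)
  show ?thesis
  proof (rule poly_eq_poly_eq_iff[THEN iffD1], rule ext)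
    fix z :: complex
    have "poly (quartic ^ n + [:of_nat c:]) z = poly p (poly quartic z)" by (simp add: p)
    then show "poly (quartic ^ n + [:of_nat c:]) z = poly (\<Prod>b\<in>radicals n c. quartic - [:b:]) z"
      by (simp add: * poly_prod)
  qed
qed

lemma quartic_height_eq:
  assumes "n > 0" "c > 0"
  shows "quartic_height n c = (\<Sum>b\<in>radicals n c. log_mahler_fibre b) / (2 * n)"
  unfolding quartic_height_def quartic_power_factorization[OF assms]
  using finite_radicals[OF assms] quartic_minus_const_nonzero
  by (simp add: log_mahler_prod log_mahler_fibre_def)

lemma radicals_scale:
  assumes "n > 0" "c > 0" "c' > 0"
  defines "t \<equiv> complex_of_real (root n (real c' / real c))"
  shows "bij_betw (\<lambda>b. t * b) (radicals n c) (radicals n c')"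
proof -
  have "t ^ n = of_real (real c' / real c)" using assms by (simp flip: of_real_power)
  then have tn: "t ^ n * of_nat c = of_nat c'" using assms(2) by simp
  have "t \<noteq> 0" using tn assms by (auto simp: power_0_left)
  then have "inj_on (\<lambda>b. t * b) (radicals n c)" by (simp add: inj_on_def)
  moreover have "(\<lambda>b. t * b) ` radicals n c \<subseteq> radicals n c'"
    using tn by (auto simp: radicals_def power_mult_distrib)
  ultimately show ?thesis
    using card_radicals assms finite_radicals
    by (intro bij_betw_imageI card_subset_eq) (auto simp: card_image)
qed

text \<open>Scaling matches the radicals of \<open>c\<close> with those of \<open>c'\<close> and
  moves each by at most \<open>(t - 1) * r\<close>, where \<open>t\<close> is the scaling factor.
  Uniform continuity on the disc of radius \<open>r\<close> bounds the change of the mean, with a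
  \<open>\<delta>\<close> that serves all \<open>n\<close>.\<close>

lemma quartic_height_step:
  assumes "e > 0"
  shows "\<exists>\<delta>>0. \<forall>n c c'. n > 0 \<longrightarrow> c > 0 \<longrightarrow> c \<le> c' \<longrightarrow> root n c' \<le> r \<longrightarrow>
    (root n (real c' / real c) - 1) * r < \<delta> \<longrightarrow> \<bar>quartic_height n c' - quartic_height n c\<bar> < e"
proof -
  have "uniformly_continuous_on (cball 0 r) log_mahler_fibre"
    using continuous_log_mahler_fibre by (intro compact_uniformly_continuous) (auto intro: continuous_on_subset)
  then obtain \<delta> where \<delta>: "\<delta> > 0" "\<And>x y. x \<in> cball 0 r \<Longrightarrow> y \<in> cball 0 r \<Longrightarrow> dist y x < \<delta> \<Longrightarrow>
      dist (log_mahler_fibre y) (log_mahler_fibre x) < e"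
    using assms unfolding uniformly_continuous_on_def by metis
  show ?thesis
  proof (intro exI[of _ \<delta>] conjI allI impI \<delta>(1))
    fix n c c' :: nat
    assume n: "n > 0" and c: "c > 0" "c \<le> c'" and r: "root n c' \<le> r"
      and d: "(root n (real c' / real c) - 1) * r < \<delta>"
    define t where "t = root n (real c' / real c)"
    have "t \<ge> 1" unfolding t_def using n c by (simp add: real_root_ge_1_iff)
    have rc: "root n c \<le> r" using r n c by (meson of_nat_mono order.trans real_root_le_mono)
    have c': "c' > 0" using c by simp
    have "\<bar>log_mahler_fibre (of_real t * b) - log_mahler_fibre b\<bar> \<le> e" if b: "b \<in> radicals n c" for b
    proof -
      have "of_real t * b \<in> radicals n c'"
        using bij_betwE[OF radicals_scale[OF n c(1) c']] b by (simp add: t_def)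
      then have "cmod (of_real t * b) \<le> r" using norm_radical[OF n] r by simp
      moreover have "cmod b \<le> r" using norm_radical[OF n b] rc by simp
      moreover have "dist (of_real t * b) b < \<delta>"
      proof -
        have "of_real t * b - b = of_real (t - 1) * b" by (simp add: algebra_simps)
        then have "dist (of_real t * b) b = (t - 1) * cmod b"
          using \<open>t \<ge> 1\<close> by (simp only: dist_norm norm_mult norm_of_real)
        also have "\<dots> \<le> (t - 1) * r" using \<open>cmod b \<le> r\<close> \<open>t \<ge> 1\<close> by (intro mult_left_mono) auto
        finally show ?thesis using d by (simp add: t_def)
      qed
      ultimately show ?thesis using \<delta>(2)[of b "of_real t * b"] by (simp add: dist_real_def)
    qed
    then have "(\<Sum>b\<in>radicals n c. \<bar>log_mahler_fibre (of_real t * b) - log_mahler_fibre b\<bar>) \<le> n * e"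
      using sum_bounded_above[of "radicals n c" "\<lambda>b. \<bar>log_mahler_fibre (of_real t * b) - log_mahler_fibre b\<bar>" e]
        card_radicals[OF n c(1)] by simp
    moreover have "(\<Sum>b\<in>radicals n c'. log_mahler_fibre b) = (\<Sum>b\<in>radicals n c. log_mahler_fibre (of_real t * b))"
      using sum.reindex_bij_betw[OF radicals_scale[OF n c(1) c'], of log_mahler_fibre] by (simp add: t_def)
    then have "quartic_height n c' - quartic_height n c =
        (\<Sum>b\<in>radicals n c. log_mahler_fibre (of_real t * b) - log_mahler_fibre b) / (2 * n)"
      by (simp add: quartic_height_eq n c c' sum_subtractf diff_divide_distrib)
    moreover have "\<bar>\<Sum>b\<in>radicals n c. log_mahler_fibre (of_real t * b) - log_mahler_fibre b\<bar> \<le>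
        (\<Sum>b\<in>radicals n c. \<bar>log_mahler_fibre (of_real t * b) - log_mahler_fibre b\<bar>)" by (rule sum_abs)
    ultimately have "\<bar>quartic_height n c' - quartic_height n c\<bar> =
        \<bar>\<Sum>b\<in>radicals n c. log_mahler_fibre (of_real t * b) - log_mahler_fibre b\<bar> / (2 * n)"
      and "\<bar>\<Sum>b\<in>radicals n c. log_mahler_fibre (of_real t * b) - log_mahler_fibre b\<bar> \<le> n * e"
      by (simp_all only: abs_divide)
    then have "\<bar>quartic_height n c' - quartic_height n c\<bar> \<le> n * e / (2 * n)"
      by (simp only: divide_right_mono)
    \<comment> \<open>The divisor \<open>2 * n\<close> against \<open>n\<close> radicals leaves
      \<open>e / 2\<close>, which restores strictness.\<close>
    also have "\<dots> < e" using n assms by simp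
    finally show "\<bar>quartic_height n c' - quartic_height n c\<bar> < e" .
  qed
qed

section \<open>Lower and upper estimates of the Mahler measure\<close>

lemma ln_prod_mset_le_log_plus:
  "(\<Prod>x\<in>#M. cmod x) > 0 \<Longrightarrow> ln (\<Prod>x\<in>#M. cmod x) \<le> (\<Sum>x\<in>#M. log_plus (cmod x))"
proof (induction M)
  case (add a M)
  have pos: "cmod a > 0" "(\<Prod>x\<in>#M. cmod x) > 0" using add.prems
    by (auto simp: zero_less_mult_iff not_less intro: order.strict_implies_order)
  have "ln (cmod a) \<le> log_plus (cmod a)" using pos by (simp add: log_plus_def)
  moreover have "ln (cmod a * (\<Prod>x\<in>#M. cmod x)) = ln (cmod a) + ln (\<Prod>x\<in>#M. cmod x)"
    using pos by (intro ln_mult_pos)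
  ultimately show ?case using add.IH[OF pos(2)] by simp
qed simp

lemma monic_eq_prod_proots: "lead_coeff p = 1 \<Longrightarrow> p = (\<Prod>x\<in>#proots p. [:- x, 1 :: complex:])"
  using complex_poly_decompose_multiset[of p] by simp

lemma poly_prod_mset_image: "poly (\<Prod>x\<in>#M. f x) z = (\<Prod>x\<in>#M. poly (f x) z)"
  by (induction M) auto

text \<open>Up to sign the constant term of a monic polynomial is the product of its roots, and each
  factor is at most its maximum with 1.\<close>

lemma log_mahler_lower_bound:
  assumes "lead_coeff p = 1" "poly p 0 \<noteq> 0"
  shows "ln (cmod (poly p 0)) \<le> log_mahler p"
proof -
  have norm: "cmod (\<Prod>x\<in>#M. - x) = (\<Prod>x\<in>#M. cmod x)" for M
    by (induction M) (auto simp: norm_mult)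
  have "poly p 0 = (\<Prod>x\<in>#proots p. - x)"
    using arg_cong[OF monic_eq_prod_proots[OF assms(1)], of "\<lambda>q. poly q 0"] by (simp add: poly_prod_mset_image)
  then have *: "cmod (poly p 0) = (\<Prod>x\<in>#proots p. cmod x)" by (simp only: norm)
  moreover have "cmod (poly p 0) > 0" using assms(2) by simp
  ultimately show ?thesis using ln_prod_mset_le_log_plus[of "proots p"] by (simp add: log_mahler_def)
qed

text \<open>An upper estimate in Jensen's formula: reflect the roots in the unit disc and apply the
  maximum principle to the quotient by \<open>a\<close>.\<close>

lemma log_mahler_upper_bound:
  assumes monic: "lead_coeff p = 1" and nz: "\<And>z. cmod z \<le> 1 \<Longrightarrow> poly a z \<noteq> 0"
    and le: "\<And>z. cmod z = 1 \<Longrightarrow> cmod (poly p z) \<le> B * cmod (poly a z)"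
  shows "exp (log_mahler p) \<le> B * cmod (poly a 0)"
proof -
  \<comment> \<open>On the unit circle 1 - cnj x z has the modulus of z - x, while its value at 0 is
    1. So \<open>q\<close> has the modulus of \<open>p\<close> on the circle and the Mahler measure
    as modulus at 0.\<close>
  define r where "r = (\<lambda>x::complex. if cmod x > 1 then [:- x, 1:] else [:1, - cnj x:])"
  define q where "q = (\<Prod>x\<in>#proots p. r x)"
  have "cmod (poly (r x) z) = cmod (z - x)" if z: "cmod z = 1" for x z
  proof -
    have "z * cnj z = 1" using z by (simp flip: complex_norm_square)
    then have "1 - cnj x * z = z * cnj (z - x)" by (simp add: algebra_simps)
    then have "cmod (1 - cnj x * z) = cmod (z - x)" using z by (metis complex_mod_cnj mult_1 norm_mult)
    then show ?thesis by (simp add: r_def algebra_simps)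
  qed
  then have circle: "cmod (poly (\<Prod>x\<in>#M. r x) z) = cmod (poly (\<Prod>x\<in>#M. [:- x, 1:]) z)" if "cmod z = 1" for M z
    using that by (induction M) (auto simp: norm_mult, simp flip: norm_mult add: left_diff_distrib)
  have "cmod (poly (r x) 0) = exp (log_plus (cmod x))" for x
  proof (cases "cmod x \<le> 1")
    case False
    then have "x \<noteq> 0" by auto
    then show ?thesis using False by (simp add: r_def log_plus_ge_1)
  qed (simp add: r_def log_plus_le_1)
  then have centre: "cmod (poly (\<Prod>x\<in>#M. r x) 0) = exp (\<Sum>x\<in>#M. log_plus (cmod x))" for M
    by (induction M) (auto simp: norm_mult exp_add)
  have "cmod (poly q 0 / poly a 0) \<le> B"
  proof (rule maximum_modulus_frontier[where f="\<lambda>z. poly q z / poly a z" and S="cball 0 1"])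
    show "(\<lambda>z. poly q z / poly a z) holomorphic_on interior (cball 0 1)"
      using nz by (intro holomorphic_intros) (auto simp: less_imp_le)
    show "continuous_on (closure (cball 0 1)) (\<lambda>z. poly q z / poly a z)"
      using nz by (intro continuous_intros) auto
    fix z :: complex assume "z \<in> frontier (cball 0 1)"
    then have z: "cmod z = 1" by simp
    have "cmod (poly q z) = cmod (poly p z)"
      using circle[OF z, of "proots p"] monic_eq_prod_proots[OF monic] by (simp add: q_def)
    then show "cmod (poly q z / poly a z) \<le> B"
      using le[OF z] nz[of z] z by (simp add: norm_divide divide_le_eq)
  qed auto
  moreover have "cmod (poly q 0) = exp (log_mahler p)" by (simp add: q_def centre log_mahler_def)
  moreover have "poly a 0 \<noteq> 0" using nz by simp
  ultimately show ?thesis by (simp add: norm_divide divide_le_eq)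
qed

section \<open>The smallest heights of the family\<close>

text \<open>Any polynomial with real coefficients is congruent to \<open>e X + f\<close> modulo \<open>X\<^sup>2 - 2 Re z X + 1\<close>,
  which vanishes at \<open>z\<close> on the unit circle.\<close>

lemma cmod_affine_on_circle:
  assumes "cmod z = 1"
  shows "(cmod (of_real e * z + of_real f))\<^sup>2 = e\<^sup>2 + f\<^sup>2 + 2 * e * f * Re z"
proof -
  have "(Re z)\<^sup>2 + (Im z)\<^sup>2 = 1" using assms by (simp add: cmod_def)
  moreover have "(cmod (of_real e * z + of_real f))\<^sup>2 = e\<^sup>2 * ((Re z)\<^sup>2 + (Im z)\<^sup>2) + f\<^sup>2 + 2 * e * f * Re z"
    unfolding cmod_power2 by (simp add: power2_eq_square algebra_simps)
  ultimately show ?thesis by simp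
qed

text \<open>The coefficients are Chebyshev polynomials of the second kind: z^k = U_(k-1)(x) z -
  U_(k-2)(x).\<close>

lemma circle_powers:
  assumes "cmod z = 1"
  defines "x \<equiv> complex_of_real (Re z)"
  shows "z ^ 2 = 2 * x * z - 1"
    and "z ^ 3 = (4 * x^2 - 1) * z - 2 * x"
    and "z ^ 4 = (8 * x^3 - 4 * x) * z - (4 * x^2 - 1)"
    and "z ^ 5 = (16 * x^4 - 12 * x^2 + 1) * z - (8 * x^3 - 4 * x)"
    and "z ^ 6 = (32 * x^5 - 32 * x^3 + 6 * x) * z - (16 * x^4 - 12 * x^2 + 1)"
proof -
  have "z * cnj z = 1" using assms by (simp flip: complex_norm_square)
  moreover have "cnj z = 2 * x - z" by (simp add: x_def complex_eq_iff)
  ultimately have 2: "z * z = 2 * x * z - 1" by (simp add: algebra_simps)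
  then show z2: "z ^ 2 = 2 * x * z - 1" by (simp add: power2_eq_square)
  show z3: "z ^ 3 = (4 * x^2 - 1) * z - 2 * x"
    using z2 by Groebner_Basis.algebra
  show z4: "z ^ 4 = (8 * x^3 - 4 * x) * z - (4 * x^2 - 1)"
    using z2 z3 by Groebner_Basis.algebra
  show z5: "z ^ 5 = (16 * x^4 - 12 * x^2 + 1) * z - (8 * x^3 - 4 * x)"
    using z2 z4 by Groebner_Basis.algebra
  show "z ^ 6 = (32 * x^5 - 32 * x^3 + 6 * x) * z - (16 * x^4 - 12 * x^2 + 1)"
    using z2 z5 by Groebner_Basis.algebra
qed

lemma cmod_quartic_on_circle:
  assumes "cmod z = 1"
  defines "c \<equiv> Re z"
  shows "(cmod (poly quartic z))\<^sup>2 = 1 + 8 * c^2 - 24 * c^3 + 16 * c^4"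
proof -
  define e where "e = 8 * c^3 - 4 * c - 2 * (4 * c^2 - 1) + 2 * (2 * c) - 1"
  define f where "f = - (4 * c^2 - 1) + 2 * (2 * c) - 1"
  have "poly quartic z = z^4 - 2 * z^3 + 2 * z^2 - z + 1"
    unfolding quartic_def by (simp, Groebner_Basis.algebra)
  also have "\<dots> = of_real e * z + of_real f"
    unfolding circle_powers[OF assms(1)] by (simp add: e_def f_def c_def, Groebner_Basis.algebra)
  finally have "(cmod (poly quartic z))\<^sup>2 = e\<^sup>2 + f\<^sup>2 + 2 * e * f * c"
    using cmod_affine_on_circle[OF assms(1)] by (simp add: c_def)
  also have "\<dots> = 1 + 8 * c^2 - 24 * c^3 + 16 * c^4"
    unfolding e_def f_def by Groebner_Basis.algebra
  finally show ?thesis .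
qed

text \<open>A near-optimal majorant: \<open>majorant\<close> has no zeros in the closed unit disc, its modulus on the
  unit circle is at least \<open>max 1 \<bar>quartic\<bar>\<close>, and its value at \<open>0\<close> is almost as small as possible. It was
  found numerically, by truncating the outer function of a trigonometric polynomial majorant of
  \<open>max 1 \<bar>quartic\<bar>\<^sup>2\<close>.\<close>

definition majorant :: "complex poly" where
  "majorant = smult (1/100) [:189, -182, 168, -112, 47, -5, -3:]"

lemma cmod_majorant_on_circle:
  assumes "cmod z = 1"
  defines "c \<equiv> Re z"
  shows "10000 * (cmod (poly majorant z))\<^sup>2 =
    10666 - 1182 * c + 72768 * c^2 - 225848 * c^3 + 203056 * c^4 - 12768 * c^5 - 36288 * c^6"
proof -
  define e where "e = - 3 * (32 * c^5 - 32 * c^3 + 6 * c) - 5 * (16 * c^4 - 12 * c^2 + 1) + 47 * (8 * c^3 - 4 * c)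
    - 112 * (4 * c^2 - 1) + 168 * (2 * c) - 182"
  define f where "f = 3 * (16 * c^4 - 12 * c^2 + 1) + 5 * (8 * c^3 - 4 * c) - 47 * (4 * c^2 - 1) + 112 * (2 * c) - 168 + 189"
  have "100 * poly majorant z = - 3 * z^6 - 5 * z^5 + 47 * z^4 - 112 * z^3 + 168 * z^2 - 182 * z + 189"
    unfolding majorant_def by (simp, Groebner_Basis.algebra)
  also have "\<dots> = of_real e * z + of_real f"
    unfolding circle_powers[OF assms(1)] by (simp add: e_def f_def c_def, Groebner_Basis.algebra)
  finally have "(cmod (100 * poly majorant z))\<^sup>2 = e\<^sup>2 + f\<^sup>2 + 2 * e * f * c"
    using cmod_affine_on_circle[OF assms(1)] by (simp add: c_def)
  also have "(cmod (100 * poly majorant z))\<^sup>2 = 10000 * (cmod (poly majorant z))\<^sup>2"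
    by (simp add: norm_mult power_mult_distrib)
  also have "e\<^sup>2 + f\<^sup>2 + 2 * e * f * c =
    10666 - 1182 * c + 72768 * c^2 - 225848 * c^3 + 203056 * c^4 - 12768 * c^5 - 36288 * c^6"
    unfolding e_def f_def by Groebner_Basis.algebra
  finally show ?thesis .
qed

text \<open>The decompositions are Bernstein expansions on the pieces of a subdivision of \<open>[-1, 1]\<close>; all
  their coefficients are nonnegative.\<close>

lemma majorant_ge_1_aux:
  fixes c :: real
  assumes "-1 \<le> c" "c \<le> 1"
  shows "10000 \<le> 10666 - 1182 * c + 72768 * c^2 - 225848 * c^3 + 203056 * c^4 - 12768 * c^5 - 36288 * c^6"
    (is "_ \<le> ?p")
proof -
  consider "c \<le> 0" | "0 \<le> c" "c \<le> 1/2" | "1/2 \<le> c" "c \<le> 3/4" | "3/4 \<le> c" by linarith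
  then have "0 \<le> ?p - 10000"
  proof cases
    case 1
    have "?p - 10000 = 480000 * (- c)^6 + 1397402 * (c - (- 1))^1 * (- c)^5 + 1339018 * (c - (- 1))^2 * (- c)^4 + 542060 * (c - (- 1))^3 * (- c)^3
      + 88668 * (c - (- 1))^4 * (- c)^2 + 5178 * (c - (- 1))^5 * (- c)^1 + 666 * (c - (- 1))^6" by Groebner_Basis.algebra
    also have "\<dots> \<ge> 0" using 1 assms by (intro add_nonneg_nonneg mult_nonneg_nonneg zero_le_power) auto
    finally show ?thesis .
  next
    case 2
    have "?p - 10000 = 42624 * (1/2 - c)^6 + 217920 * c^1 * (1/2 - c)^5 + 1614528 * c^2 * (1/2 - c)^4 + 3324608 * c^3 * (1/2 - c)^3
      + 2638720 * c^4 * (1/2 - c)^2 + 902336 * c^5 * (1/2 - c)^1 + 112704 * c^6" by Groebner_Basis.algebra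
    also have "\<dots> \<ge> 0" using 2 assms by (intro add_nonneg_nonneg mult_nonneg_nonneg zero_le_power) auto
    finally show ?thesis .
  next
    case 3
    have "?p - 10000 = 7213056 * (3/4 - c)^6 + 36042752 * (c - 1/2)^1 * (3/4 - c)^5 + 69099520 * (c - 1/2)^2 * (3/4 - c)^4 + 63919616 * (c - 1/2)^3 * (3/4 - c)^3
      + 29954304 * (c - 1/2)^4 * (3/4 - c)^2 + 7125888 * (c - 1/2)^5 * (3/4 - c)^1 + 785088 * (c - 1/2)^6" by Groebner_Basis.algebra
    also have "\<dots> \<ge> 0" using 3 assms by (intro add_nonneg_nonneg mult_nonneg_nonneg zero_le_power) auto
    finally show ?thesis .
  next
    case 4
    have "?p - 10000 = 785088 * (1 - c)^6 + 2295168 * (c - 3/4)^1 * (1 - c)^5 + 5800704 * (c - 3/4)^2 * (1 - c)^4 + 16293376 * (c - 3/4)^3 * (1 - c)^3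
      + 22835200 * (c - 3/4)^4 * (1 - c)^2 + 12523520 * (c - 3/4)^5 * (1 - c)^1 + 1654784 * (c - 3/4)^6" by Groebner_Basis.algebra
    also have "\<dots> \<ge> 0" using 4 assms by (intro add_nonneg_nonneg mult_nonneg_nonneg zero_le_power) auto
    finally show ?thesis .
  qed
  then show ?thesis by simp
qed

lemma majorant_ge_quartic_aux:
  fixes c :: real
  assumes "-1 \<le> c" "c \<le> 1"
  shows "10000 * (1 + 8 * c^2 - 24 * c^3 + 16 * c^4) \<le>
    10666 - 1182 * c + 72768 * c^2 - 225848 * c^3 + 203056 * c^4 - 12768 * c^5 - 36288 * c^6"
    (is "?q \<le> ?p")
proof -
  consider "c \<le> -1/2" | "-1/2 \<le> c" "c \<le> 0" | "0 \<le> c" "c \<le> 1/2" | "1/2 \<le> c" by linarith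
  then have "0 \<le> ?p - ?q"
  proof cases
    case 1
    \<comment> \<open>The term in \<open>(-1/2 - c)^6\<close> is missing because both sides equal
      490000 at c = -1: \<open>majorant\<close> and \<open>quartic\<close> both take the value 7 at
      -1.\<close>
    have "?p - ?q = 1196864 * (c - (- 1))^1 * (-1/2 - c)^5 + 2656448 * (c - (- 1))^2 * (-1/2 - c)^4 + 2177216 * (c - (- 1))^3 * (-1/2 - c)^3 + 811904 * (c - (- 1))^4 * (-1/2 - c)^2
      + 143552 * (c - (- 1))^5 * (-1/2 - c)^1 + 12992 * (c - (- 1))^6" by Groebner_Basis.algebra
    also have "\<dots> \<ge> 0" using 1 assms by (intro add_nonneg_nonneg mult_nonneg_nonneg zero_le_power) auto
    finally show ?thesis .
  next
    case 2
    have "?p - ?q = 12992 * (- c)^6 + 12352 * (c - (- 1/2))^1 * (- c)^5 + 155904 * (c - (- 1/2))^2 * (- c)^4 + 654656 * (c - (- 1/2))^3 * (- c)^3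
      + 712768 * (c - (- 1/2))^4 * (- c)^2 + 293568 * (c - (- 1/2))^5 * (- c)^1 + 42624 * (c - (- 1/2))^6" by Groebner_Basis.algebra
    also have "\<dots> \<ge> 0" using 2 assms by (intro add_nonneg_nonneg mult_nonneg_nonneg zero_le_power) auto
    finally show ?thesis .
  next
    case 3
    have "?p - ?q = 42624 * (1/2 - c)^6 + 217920 * c^1 * (1/2 - c)^5 + 334528 * c^2 * (1/2 - c)^4 + 124608 * c^3 * (1/2 - c)^3
      + 78720 * c^4 * (1/2 - c)^2 + 262336 * c^5 * (1/2 - c)^1 + 112704 * c^6" by Groebner_Basis.algebra
    also have "\<dots> \<ge> 0" using 3 assms by (intro add_nonneg_nonneg mult_nonneg_nonneg zero_le_power) auto
    finally show ?thesis .
  next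
    case 4
    have "?p - ?q = 112704 * (1 - c)^6 + 1090112 * (c - 1/2)^1 * (1 - c)^5 + 4217600 * (c - 1/2)^2 * (1 - c)^4 + 8044352 * (c - 1/2)^3 * (1 - c)^3
      + 7538240 * (c - 1/2)^4 * (1 - c)^2 + 2796224 * (c - 1/2)^5 * (1 - c)^1 + 25856 * (c - 1/2)^6" by Groebner_Basis.algebra
    also have "\<dots> \<ge> 0" using 4 assms by (intro add_nonneg_nonneg mult_nonneg_nonneg zero_le_power) auto
    finally show ?thesis .
  qed
  then show ?thesis by simp
qed

lemma majorant_on_circle:
  assumes "cmod z = 1"
  shows "1 \<le> cmod (poly majorant z)" "cmod (poly quartic z) \<le> cmod (poly majorant z)"
proof -
  have c: "-1 \<le> Re z" "Re z \<le> 1" using abs_Re_le_cmod[of z] assms by auto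
  have "1\<^sup>2 \<le> (cmod (poly majorant z))\<^sup>2"
    using majorant_ge_1_aux[OF c] cmod_majorant_on_circle[OF assms] by simp
  then show "1 \<le> cmod (poly majorant z)" by (rule power2_le_imp_le) simp
  have "(cmod (poly quartic z))\<^sup>2 \<le> (cmod (poly majorant z))\<^sup>2"
    using majorant_ge_quartic_aux[OF c] cmod_majorant_on_circle[OF assms] cmod_quartic_on_circle[OF assms] by simp
  then show "cmod (poly quartic z) \<le> cmod (poly majorant z)" by (rule power2_le_imp_le) simp
qed

lemma cmod_poly_le_sum_coeffs:
  assumes "cmod z \<le> 1"
  shows "cmod (poly p z) \<le> sum_list (map cmod (coeffs p))"
proof (induction p)
  case (pCons a p)
  have "cmod (poly (pCons a p) z) \<le> cmod a + cmod z * cmod (poly p z)"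
    by (simp add: norm_triangle_le norm_mult)
  also have "\<dots> \<le> cmod a + cmod (poly p z)"
    using assms by (simp add: mult_left_le_one_le)
  finally show ?case using pCons by (simp add: cCons_def)
qed simp

text \<open>The constant term of the product with \<open>1 + X + 3/10 X\<^sup>2\<close> dominates the other coefficients.\<close>

lemma majorant_nonzero:
  assumes "cmod z \<le> 1"
  shows "poly majorant z \<noteq> 0"
proof
  assume z: "poly majorant z = 0"
  \<comment> \<open>For \<open>majorant\<close> itself the comparison fails, since 182 + 168 + 112 +
    47 + 5 + 3 exceeds 189. After multiplication the moduli of the nonconstant coefficients add up
    to 856, below 1890.\<close>
  have "1000 * poly majorant z * (1 + z + 3/10 * z^2) =
    1890 + poly [:0, 70, 427, 14, -146, 84, 61, -45, -9:] z"
    unfolding majorant_def by (simp, Groebner_Basis.algebra)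
  then have "poly [:0, 70, 427, 14, -146, 84, 61, -45, -9:] z = - 1890" using z by (simp add: eq_neg_iff_add_eq_0 add.commute)
  then have "cmod (poly [:0, 70, 427, 14, -146, 84, 61, -45, -9:] z) = 1890" by simp
  moreover have "cmod (poly [:0, 70, 427, 14, -146, 84, 61, -45, -9:] z) \<le> 856"
    using cmod_poly_le_sum_coeffs[OF assms, of "[:0, 70, 427, 14, -146, 84, 61, -45, -9:]"] by (simp add: cCons_def)
  ultimately show False by simp
qed

lemma exp_ge_partial_sum:
  fixes x :: real assumes "x \<ge> 0"
  shows "(\<Sum>k<n. x ^ k / fact k) \<le> exp x"
proof -
  have "(\<lambda>k. x ^ k / fact k) sums exp x"
    using exp_converges[of x] by (simp add: divide_inverse mult.commute)
  then show ?thesis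
    using assms sum_le_suminf[of "\<lambda>k. x ^ k / fact k" "{..<n}"] by (simp add: sums_iff)
qed

text \<open>Here 189/100 is the value of \<open>majorant\<close> at 0, and 0.638896 is twice
  0.319448. The logarithm is about 0.6366, so six terms of the exponential series at 0.638 are
  enough.\<close>

lemma ln_189: "ln (189/100 :: real) < 0.638896"
proof -
  have "(189/100 :: real) < (\<Sum>k<6. (0.638 :: real) ^ k / fact k)"
    by (simp add: eval_nat_numeral)
  also have "\<dots> \<le> exp 0.638" by (rule exp_ge_partial_sum) simp
  finally have "exp (ln (189/100 :: real)) < exp 0.638" by simp
  then have "ln (189/100 :: real) < 0.638" by (simp only: exp_less_cancel_iff)
  then show ?thesis by simp
qed

text \<open>On the unit circle the n-th power of |majorant| dominates both |quartic|^n and 1, so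
  three times it dominates |quartic^n + 2|. \<open>log_mahler_upper_bound\<close> then bounds the
  Mahler measure by 3 (189/100)^n; the factor 3 costs only ln 3 / (2 n).\<close>

lemma quartic_height_2:
  assumes "n > 0"
  shows "quartic_height n 2 \<le> ln 3 / (2 * n) + 0.319448"
proof -
  define p :: "complex poly" where "p = quartic ^ n + [:of_nat 2:]"
  have "p = map_poly of_int ((quartic :: int poly) ^ n + [:2:])"
    by (simp add: p_def of_int_quartic_power)
  moreover have "lead_coeff (map_poly complex_of_int q) = of_int (lead_coeff q)" for q
    by (simp add: coeff_map_poly degree_map_poly)
  ultimately have monic: "lead_coeff p = 1"
    using monic_quartic_power(2)[OF assms, of 2] by (simp only: of_int_1)
  have "exp (log_mahler p) \<le> 3 * cmod (poly (majorant ^ n) 0)"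
  proof (rule log_mahler_upper_bound[OF monic])
    fix z assume z: "cmod z = 1"
    have "poly p z = poly quartic z ^ n + 2" by (simp add: p_def)
    then have "cmod (poly p z) \<le> cmod (poly quartic z) ^ n + 2"
      using norm_triangle_ineq[of "poly quartic z ^ n" 2] by (simp only: norm_power norm_numeral)
    also have "\<dots> \<le> cmod (poly majorant z) ^ n + 2 * cmod (poly majorant z) ^ n"
      using power_mono[OF majorant_on_circle(2)[OF z], of n] one_le_power[OF majorant_on_circle(1)[OF z], of n]
      by simp
    finally show "cmod (poly p z) \<le> 3 * cmod (poly (majorant ^ n) z)" by (simp add: norm_power)
  qed (simp add: majorant_nonzero)
  also have "\<dots> = 3 * (189/100) ^ n" by (simp add: majorant_def norm_power)
  finally have "log_mahler p \<le> ln (3 * (189/100) ^ n)" by (subst ln_ge_iff) simp_all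
  also have "\<dots> = ln 3 + ln ((189/100) ^ n)" by (rule ln_mult_pos) simp_all
  also have "ln ((189/100 :: real) ^ n) = n * ln (189/100)" by (rule ln_realpow)
  also have "ln 3 + n * ln (189/100 :: real) \<le> ln 3 + n * 0.638896" using ln_189 by (intro add_left_mono mult_left_mono) auto
  finally have "log_mahler p / (2 * n) \<le> (ln 3 + n * 0.638896) / (2 * n)" by (rule divide_right_mono) simp
  also have "\<dots> = ln 3 / (2 * n) + 0.319448" using assms by (simp add: add_divide_distrib)
  finally show ?thesis by (simp add: quartic_height_def p_def)
qed

text \<open>Since \<open>quartic\<close> is 1 at 0, the constant term is 1 + c. The bound makes the
  heights unbounded in \<open>c\<close>, and conversely confines the radicals to a disc when the
  height is bounded.\<close>

lemma quartic_height_lower_bound: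
  assumes "n > 0" "c > 0"
  shows "ln c / (2 * n) \<le> quartic_height n c"
proof -
  define p :: "complex poly" where "p = quartic ^ n + [:of_nat c:]"
  have "p = map_poly of_int ((quartic :: int poly) ^ n + [:int c:])"
    by (simp add: p_def of_int_quartic_power)
  moreover have "lead_coeff (map_poly complex_of_int q) = of_int (lead_coeff q)" for q
    by (simp add: coeff_map_poly degree_map_poly)
  ultimately have monic: "lead_coeff p = 1"
    using monic_quartic_power(2)[OF assms(1), of "int c"] by (simp only: of_int_1)
  have p0: "poly p 0 = of_nat (1 + c)" by (simp add: p_def poly_quartic)
  have "ln (real (1 + c)) \<le> log_mahler p"
    using log_mahler_lower_bound[OF monic] unfolding p0 norm_of_nat of_nat_eq_0_iff by simp
  moreover have "ln c \<le> ln (real (1 + c))" using assms by simp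
  ultimately show ?thesis by (simp add: quartic_height_def p_def divide_right_mono)
qed

section \<open>Density\<close>

lemma ln_3_over_n_tendsto: "(\<lambda>n. ln 3 / (2 * real n)) \<longlonglongrightarrow> 0"
proof -
  have "(\<lambda>n. ln 3 / 2 * (1 / real n)) \<longlonglongrightarrow> ln 3 / 2 * 0"
    by (intro tendsto_intros lim_1_over_n)
  then show ?thesis by simp
qed

lemma quartic_height_2_eventually:
  "eventually (\<lambda>n. n > 0 \<and> quartic_height n 2 \<le> 0.31944909) sequentially"
proof -
  \<comment> \<open>The slack is 0.31944909 - 0.319448.\<close>
  have "eventually (\<lambda>n. ln 3 / (2 * real n) < 0.00000109) sequentially"
    by (rule order_tendstoD(2)[OF ln_3_over_n_tendsto]) simp
  then show ?thesis using eventually_gt_at_top[of 0]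
  proof eventually_elim
    case (elim n)
    then have "quartic_height n 2 \<le> 0.00000109 + 0.319448" using quartic_height_2[of n] by linarith
    also have "\<dots> = (0.31944909 :: real)" by simp
    finally show ?case using elim by simp
  qed
qed

lemma root_le_exp_if_quartic_height_less:
  assumes "n > 0" "c > 0" "quartic_height n c < \<theta>"
  shows "root n c \<le> exp (2 * \<theta>)"
proof -
  have "ln c / (2 * n) < \<theta>" using quartic_height_lower_bound[OF assms(1,2)] assms(3) by linarith
  then have "ln (root n c) \<le> 2 * \<theta>" using assms by (simp add: ln_root field_simps)
  moreover have "root n c > 0" using assms by simp
  ultimately show ?thesis by (metis exp_le_cancel_iff exp_ln)
qed

text \<open>For one large even \<open>n\<close> the heights start at or below
  \<open>\<theta>\<close>, exceed it eventually and change by less than \<open>e\<close> at each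
  step. The first height that reaches \<open>\<theta>\<close> is therefore within \<open>e\<close>
  of it.\<close>

lemma quartic_heights_dense:
  assumes \<theta>: "\<theta> \<ge> 0.31944909" and e: "e > 0"
  shows "\<exists>n c. even n \<and> n > 0 \<and> c mod 4 = 2 \<and> \<bar>quartic_height n c - \<theta>\<bar> < e"
proof -
  \<comment> \<open>A constant term with height below \<open>\<theta>\<close> has its n-th root at
    most \<open>exp (2 * \<theta>)\<close>. The next constant is at most three times larger, so its
    n-th root is at most \<open>r\<close>. This radius is fixed before \<open>n\<close> is
    chosen.\<close>
  define r where "r = 3 * exp (2 * \<theta>)"
  have r: "r > 0" by (simp add: r_def)
  obtain \<delta> where \<delta>: "\<delta> > 0" and step: "\<And>n c c'. n > 0 \<Longrightarrow> c > 0 \<Longrightarrow> c \<le> c' \<Longrightarrow> root n c' \<le> r \<Longrightarrow>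
      (root n (real c' / real c) - 1) * r < \<delta> \<Longrightarrow> \<bar>quartic_height n c' - quartic_height n c\<bar> < e"
    using quartic_height_step[OF e, of r] by metis
  have "(\<lambda>n. (root n 3 - 1) * r) \<longlonglongrightarrow> (1 - 1) * r"
    by (intro tendsto_intros LIMSEQ_root_const) simp
  then have "eventually (\<lambda>n. (root n 3 - 1) * r < \<delta>) sequentially"
    using \<delta> by (intro order_tendstoD(2)) auto
  with quartic_height_2_eventually
  have "eventually (\<lambda>n. (n > 0 \<and> quartic_height n 2 \<le> 0.31944909) \<and> (root n 3 - 1) * r < \<delta>) sequentially"
    by (rule eventually_conj)
  then obtain M where M: "\<And>n. n \<ge> M \<Longrightarrow> n > 0 \<and> quartic_height n 2 \<le> 0.31944909 \<and> (root n 3 - 1) * r < \<delta>"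
    unfolding eventually_sequentially by blast
  define n where "n = 2 * M"
  have n: "even n" "n > 0" "quartic_height n 2 \<le> \<theta>" "(root n 3 - 1) * r < \<delta>"
    using M[of n] \<theta> by (auto simp: n_def)
  define c where "c = (\<lambda>j::nat. 4 * j + 2)"
  have c: "c j > 0" "c j mod 4 = 2" for j unfolding c_def by (simp, presburger)
  have "\<exists>j. \<theta> \<le> quartic_height n (c j)"
  proof -
    obtain j :: nat where "exp (2 * n * \<theta>) \<le> real j" using real_arch_simple by blast
    also have "\<dots> \<le> c j" by (simp add: c_def)
    finally have "2 * n * \<theta> \<le> ln (c j)" by (subst ln_ge_iff) (use c in auto)
    then have "\<theta> \<le> ln (c j) / (2 * n)" using n(2) by (simp add: field_simps)
    also have "\<dots> \<le> quartic_height n (c j)" using quartic_height_lower_bound[OF n(2) c(1)[of j]] by (simp only: of_nat_mult of_nat_numeral)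
    finally show ?thesis ..
  qed
  define j where "j = (LEAST j. \<theta> \<le> quartic_height n (c j))"
  have j: "\<theta> \<le> quartic_height n (c j)"
    unfolding j_def using \<open>\<exists>j. _ j\<close> by (rule LeastI_ex)
  have "\<bar>quartic_height n (c j) - \<theta>\<bar> < e"
  proof (cases j)
    case 0
    then have "c j = 2" by (simp add: c_def)
    then show ?thesis using j n(3) e by simp
  next
    case (Suc i)
    have i: "quartic_height n (c i) < \<theta>"
      using not_less_Least[of i "\<lambda>j. \<theta> \<le> quartic_height n (c j)"] Suc by (simp add: j_def)
    \<comment> \<open>The extreme case is the first step, from 2 to 6.\<close>
    have ratio: "real (c j) / real (c i) \<le> 3" "c i \<le> c j" by (simp_all add: c_def Suc field_simps)
    have "root n (c j) \<le> root n (3 * c i)"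
      using n(2) ratio(1) c(1)[of i] by (intro real_root_le_mono) (simp_all add: field_simps)
    also have "\<dots> = root n 3 * root n (c i)" by (simp add: real_root_mult)
    also have "\<dots> \<le> 3 * exp (2 * \<theta>)"
    proof (rule mult_mono)
      show "root n 3 \<le> 3" using real_root_decreasing[of 1 n 3] n(2) by simp
      show "root n (c i) \<le> exp (2 * \<theta>)" by (rule root_le_exp_if_quartic_height_less[OF n(2) c(1) i])
    qed (use n(2) in auto)
    finally have "root n (c j) \<le> r" by (simp add: r_def)
    moreover have "(root n (real (c j) / real (c i)) - 1) * r \<le> (root n 3 - 1) * r"
      using n(2) ratio(1) r by (intro mult_right_mono diff_right_mono real_root_le_mono) auto
    ultimately have "\<bar>quartic_height n (c j) - quartic_height n (c i)\<bar> < e"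
      using n(4) by (intro step[OF n(2) c(1) ratio(2)]) linarith+
    then show ?thesis using i j by linarith
  qed
  then show ?thesis using n c by blast
qed

text \<open>One root is chosen for each large even \<open>n\<close>. The modulus of
  \<open>quartic\<close> there is the n-th root of 2, which differs for different \<open>n\<close>,
  so the chosen roots are distinct.\<close>

lemma infinite_small_height:
  "infinite {\<alpha>. algebraic \<alpha> \<and> zhang_zagier_height \<alpha> \<le> 0.31944909}"
proof -
  obtain M where M: "\<And>n. n \<ge> M \<Longrightarrow> n > 0 \<and> quartic_height n 2 \<le> 0.31944909"
    using quartic_height_2_eventually unfolding eventually_sequentially by blast
  define a where "a = (\<lambda>n. SOME \<alpha>::complex. poly quartic \<alpha> ^ n = - of_nat 2)"
  have a: "poly quartic (a n) ^ n = - of_nat 2" if "n > 0" for n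
    unfolding a_def using exists_quartic_root[OF that, of 2] by (rule someI_ex)
  define I where "I = {n. even n \<and> n \<ge> M}"
  have "\<exists>n\<ge>k. n \<in> I" for k
    by (intro exI[of _ "2 * (k + M)"]) (auto simp: I_def)
  then have "infinite I" by (meson infinite_nat_iff_unbounded_le)
  moreover have "inj_on a I"
  proof (rule inj_onI)
    fix n m assume nm: "n \<in> I" "m \<in> I" "a n = a m"
    have pos: "n > 0" "m > 0" using nm M by (auto simp: I_def)
    define x where "x = cmod (poly quartic (a n))"
    have "x ^ n = cmod (- of_nat 2)" "x ^ m = cmod (- of_nat 2)"
      using a[OF pos(1)] a[OF pos(2)] nm(3) unfolding x_def by (metis norm_power)+
    then have x: "x ^ n = 2" "x ^ m = 2" by simp_all
    have "x > 1"
    proof (rule ccontr)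
      assume "\<not> x > 1"
      then have "x ^ n \<le> 1" by (intro power_le_one) (auto simp: x_def)
      then show False using x by simp
    qed
    then show "n = m" using x by (metis power_inject_exp)
  qed
  ultimately have "infinite (a ` I)" by (simp add: finite_image_iff)
  moreover have "a ` I \<subseteq> {\<alpha>. algebraic \<alpha> \<and> zhang_zagier_height \<alpha> \<le> 0.31944909}"
  proof
    fix \<alpha> assume "\<alpha> \<in> a ` I"
    then obtain n where n: "even n" "n \<ge> M" "\<alpha> = a n" by (auto simp: I_def)
    then show "\<alpha> \<in> {\<alpha>. algebraic \<alpha> \<and> zhang_zagier_height \<alpha> \<le> 0.31944909}"
      using quartic_height_attained[of n 2 \<alpha>] a M[of n] by auto
  qed
  ultimately show ?thesis using infinite_super by blast
qed

theorem theoremA: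
  shows "{0.31944909..} \<subseteq> closure (zhang_zagier_height ` {\<alpha>. algebraic \<alpha>}) \<and>
         essential_minimum zhang_zagier_height \<le> ereal 0.31944909"
proof
  show "{0.31944909..} \<subseteq> closure (zhang_zagier_height ` {\<alpha>. algebraic \<alpha>})"
  proof
    fix \<theta> :: real assume "\<theta> \<in> {0.31944909..}"
    then have \<theta>: "\<theta> \<ge> 0.31944909" by simp
    show "\<theta> \<in> closure (zhang_zagier_height ` {\<alpha>. algebraic \<alpha>})"
      unfolding closure_approachable
    proof (intro allI impI)
      fix e :: real assume "e > 0"
      then obtain n c where nc: "even n" "n > 0" "c mod 4 = 2" "\<bar>quartic_height n c - \<theta>\<bar> < e"
        using quartic_heights_dense[OF \<theta>] by blast
      obtain \<alpha> :: complex where "poly quartic \<alpha> ^ n = - of_nat c"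
        using exists_quartic_root[OF nc(2)] by blast
      from quartic_height_attained[OF nc(1-3) this] nc(4)
      show "\<exists>y\<in>zhang_zagier_height ` {\<alpha>. algebraic \<alpha>}. dist y \<theta> < e"
        by (auto simp: dist_real_def)
    qed
  qed
  show "essential_minimum zhang_zagier_height \<le> ereal 0.31944909"
    unfolding essential_minimum_def using infinite_small_height by (intro Inf_lower) auto
qed

end
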